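(* A double category of relations is locally posetal if and only if its accompanying factorisation system is proper.
   Context: A double category $\mathbb{D}$ is a pseudo double category: a category $\mathbb{D}_0=\mathbf{V}(\mathbb{D})$ of objects and vertical arrows, a category $\mathbb{D}_1$ of horizontal arrows $p\colon A\nrightarrow B$ and cells, with source, target, horizontal identities $\mathrm{Id}_A$ and horizontal composition associative and unital up to coherent isomorphism. Equivalence of double categories means equivalence in the 2-category of double categories, pseudo double functors and vertical transformations. A stable orthogonal factorisation system $(E,M)$ is an orthogonal factorisation system with $E$ stable under pullback; it is proper if every arrow in $E$ is an epimorphism and every arrow in $M$ is a monomorphism. For a category $\mathbf{C}$ with finite limits and a stable orthogonal factorisation system $(E,M)$ on it, the double category $\mathbb{R}\mathrm{el}_{E,M}(\mathbf{C})$ has vertical category $\mathbf{C}$; horizontal arrows $A\nrightarrow B$ are arrows $\langle l,r\rangle\colon R\to A\times B$ in $M$; a cell from $R\to A\times B$ to $S\to C\times D$ with vertical sides $f\colon A\to C$, $g\colon B\to D$ is an arrow $R\to S$ commuting with $f\times g$ and the structure arrows; the composite of $R\colon A\nrightarrow B$ and $S\colon B\nrightarrow C$ is the $M$-part of the $(E,M)$-factorisation of $R\times_BS\to A\times C$; the identity on $A$ is the $M$-part of the factorisation of the diagonal $A\to A\times A$. A double category of relations is a double category $\mathbb{D}$ equivalent to some such $\mathbb{R}\mathrm{el}_{E,M}(\mathbf{C})$. Its accompanying factorisation system is the factorisation system on $\mathbf{V}(\mathbb{D})$ corresponding to $(E,M)$ under the induced equivalence $\mathbf{V}(\mathbb{D})\simeq\mathbf{C}$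 (it is uniquely determined by $\mathbb{D}$). A double category is locally preordered if for any pair of vertical arrows and pair of horizontal arrows forming a boundary there is at most one cell with that boundary. It is locally posetal if it is locally preordered and its vertical 2-category is locally posetal (every hom-category is a poset); the vertical 2-category has objects and vertical arrows of $\mathbb{D}$ as objects and 1-cells, and its 2-cells $f\Rightarrow g\colon A\to B$ are the cells $\mathrm{Id}_A\to\mathrm{Id}_B$ with left side $f$ and right side $g$. *)

theory Defs
  imports Main
begin

section \<open>Categories, functors, limits\<close>

record ('o, 'a) cat =
  Obj :: "'o set"
  Arr :: "'a set"
  Dom :: "'a \<Rightarrow> 'o"
  Cod :: "'a \<Rightarrow> 'o"
  Idn :: "'o \<Rightarrow> 'a"
  Cmp :: "'a \<Rightarrow> 'a \<Rightarrow> 'a"  (infixl \<open>\<cdot>\<index>\<close> 75)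

text \<open>\<open>g \<cdot>\<^bsub>C\<^esub> f\<close> is \<open>g\<close> after \<open>f\<close>.  All operations are only meaningful on the carriers.\<close>

definition in_hom :: "('o, 'a, 'z) cat_scheme \<Rightarrow> 'a \<Rightarrow> 'o \<Rightarrow> 'o \<Rightarrow> bool" where
  "in_hom C f A B \<longleftrightarrow> f \<in> Arr C \<and> Dom C f = A \<and> Cod C f = B"

locale category =
  fixes C :: "('o, 'a, 'z) cat_scheme" (structure)
  assumes Dom_Obj: "f \<in> Arr C \<Longrightarrow> Dom C f \<in> Obj C"
    and Cod_Obj: "f \<in> Arr C \<Longrightarrow> Cod C f \<in> Obj C"
    and Idn_hom: "A \<in> Obj C \<Longrightarrow> in_hom C (Idn C A) A A"
    and Cmp_hom: "\<lbrakk>in_hom C f X Y; in_hom C g Y Z\<rbrakk> \<Longrightarrow> in_hom C (g \<cdot> f) X Z"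
    and Cmp_Idn_right: "in_hom C f X Y \<Longrightarrow> f \<cdot> Idn C X = f"
    and Cmp_Idn_left: "in_hom C f X Y \<Longrightarrow> Idn C Y \<cdot> f = f"
    and Cmp_assoc: "\<lbrakk>in_hom C f W X; in_hom C g X Y; in_hom C h Y Z\<rbrakk>
                    \<Longrightarrow> h \<cdot> (g \<cdot> f) = (h \<cdot> g) \<cdot> f"

definition is_mono :: "('o, 'a, 'z) cat_scheme \<Rightarrow> 'a \<Rightarrow> bool" where
  "is_mono C m \<longleftrightarrow> m \<in> Arr C \<and>
     (\<forall>X f g. in_hom C f X (Dom C m) \<and> in_hom C g X (Dom C m) \<and> m \<cdot>\<^bsub>C\<^esub> f = m \<cdot>\<^bsub>C\<^esub> g \<longrightarrow> f = g)"

definition is_epi :: "('o, 'a, 'z) cat_scheme \<Rightarrow> 'a \<Rightarrow> bool" where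
  "is_epi C e \<longleftrightarrow> e \<in> Arr C \<and>
     (\<forall>X f g. in_hom C f (Cod C e) X \<and> in_hom C g (Cod C e) X \<and> f \<cdot>\<^bsub>C\<^esub> e = g \<cdot>\<^bsub>C\<^esub> e \<longrightarrow> f = g)"

definition inverse_arrows :: "('o, 'a, 'z) cat_scheme \<Rightarrow> 'a \<Rightarrow> 'a \<Rightarrow> bool" where
  "inverse_arrows C f g \<longleftrightarrow> f \<in> Arr C \<and> in_hom C g (Cod C f) (Dom C f) \<and>
     g \<cdot>\<^bsub>C\<^esub> f = Idn C (Dom C f) \<and> f \<cdot>\<^bsub>C\<^esub> g = Idn C (Cod C f)"

definition is_iso :: "('o, 'a, 'z) cat_scheme \<Rightarrow> 'a \<Rightarrow> bool" where
  "is_iso C f \<longleftrightarrow> (\<exists>g. inverse_arrows C f g)"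

definition the_inverse :: "('o, 'a, 'z) cat_scheme \<Rightarrow> 'a \<Rightarrow> 'a" where
  "the_inverse C f = (THE g. inverse_arrows C f g)"

record ('o, 'a, 'p, 'b) ftor =
  FObj :: "'o \<Rightarrow> 'p"
  FArr :: "'a \<Rightarrow> 'b"

definition is_functor ::
  "('o, 'a, 'z) cat_scheme \<Rightarrow> ('p, 'b, 'y) cat_scheme \<Rightarrow> ('o, 'a, 'p, 'b) ftor \<Rightarrow> bool" where
  "is_functor C D F \<longleftrightarrow>
     (\<forall>A\<in>Obj C. FObj F A \<in> Obj D) \<and>
     (\<forall>f A B. in_hom C f A B \<longrightarrow> in_hom D (FArr F f) (FObj F A) (FObj F B)) \<and>
     (\<forall>A\<in>Obj C. FArr F (Idn C A) = Idn D (FObj F A)) \<and>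
     (\<forall>f g X Y Z. in_hom C f X Y \<and> in_hom C g Y Z \<longrightarrow>
        FArr F (g \<cdot>\<^bsub>C\<^esub> f) = FArr F g \<cdot>\<^bsub>D\<^esub> FArr F f)"

definition id_ftor :: "('o, 'a, 'o, 'a) ftor" where
  "id_ftor = \<lparr>FObj = \<lambda>A. A, FArr = \<lambda>f. f\<rparr>"

definition comp_ftor ::
  "('p, 'b, 'q, 'c) ftor \<Rightarrow> ('o, 'a, 'p, 'b) ftor \<Rightarrow> ('o, 'a, 'q, 'c) ftor" where
  "comp_ftor G F = \<lparr>FObj = \<lambda>A. FObj G (FObj F A), FArr = \<lambda>f. FArr G (FArr F f)\<rparr>"

definition natural_transformation ::
  "('o, 'a, 'z) cat_scheme \<Rightarrow> ('p, 'b, 'y) cat_scheme \<Rightarrow> ('o, 'a, 'p, 'b) ftor \<Rightarrow>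
   ('o, 'a, 'p, 'b) ftor \<Rightarrow> ('o \<Rightarrow> 'b) \<Rightarrow> bool" where
  "natural_transformation C D F G \<tau> \<longleftrightarrow>
     (\<forall>A\<in>Obj C. in_hom D (\<tau> A) (FObj F A) (FObj G A)) \<and>
     (\<forall>f A B. in_hom C f A B \<longrightarrow> FArr G f \<cdot>\<^bsub>D\<^esub> \<tau> A = \<tau> B \<cdot>\<^bsub>D\<^esub> FArr F f)"

definition is_cone ::
  "('i, 'u, 'y) cat_scheme \<Rightarrow> ('o, 'a, 'z) cat_scheme \<Rightarrow> ('i, 'u, 'o, 'a) ftor \<Rightarrow>
   'o \<Rightarrow> ('i \<Rightarrow> 'a) \<Rightarrow> bool" where
  "is_cone J C F X \<pi> \<longleftrightarrow> X \<in> Obj C \<and>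
     (\<forall>j\<in>Obj J. in_hom C (\<pi> j) X (FObj F j)) \<and>
     (\<forall>u j k. in_hom J u j k \<longrightarrow> FArr F u \<cdot>\<^bsub>C\<^esub> \<pi> j = \<pi> k)"

definition is_limit ::
  "('i, 'u, 'y) cat_scheme \<Rightarrow> ('o, 'a, 'z) cat_scheme \<Rightarrow> ('i, 'u, 'o, 'a) ftor \<Rightarrow>
   'o \<Rightarrow> ('i \<Rightarrow> 'a) \<Rightarrow> bool" where
  "is_limit J C F L \<pi> \<longleftrightarrow> is_cone J C F L \<pi> \<and>
     (\<forall>X \<rho>. is_cone J C F X \<rho> \<longrightarrow>
        (\<exists>!h. in_hom C h X L \<and> (\<forall>j\<in>Obj J. \<pi> j \<cdot>\<^bsub>C\<^esub> h = \<rho> j)))"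

text \<open>Every finite category is isomorphic to one whose objects and arrows are natural numbers,
  so it suffices to quantify over those.\<close>

definition has_finite_limits :: "('o, 'a, 'z) cat_scheme \<Rightarrow> bool" where
  "has_finite_limits C \<longleftrightarrow>
     (\<forall>(J :: (nat, nat) cat) F. category J \<and> finite (Obj J) \<and> finite (Arr J) \<and> is_functor J C F
        \<longrightarrow> (\<exists>L \<pi>. is_limit J C F L \<pi>))"

definition is_product :: "('o, 'a, 'z) cat_scheme \<Rightarrow> 'o \<Rightarrow> 'o \<Rightarrow> 'a \<Rightarrow> 'a \<Rightarrow> bool" where
  "is_product C A B p q \<longleftrightarrow> in_hom C p (Dom C p) A \<and> in_hom C q (Dom C p) B \<and>
     (\<forall>X f g. in_hom C f X A \<and> in_hom C g X B \<longrightarrow>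
        (\<exists>!h. in_hom C h X (Dom C p) \<and> p \<cdot>\<^bsub>C\<^esub> h = f \<and> q \<cdot>\<^bsub>C\<^esub> h = g))"

definition is_pullback :: "('o, 'a, 'z) cat_scheme \<Rightarrow> 'a \<Rightarrow> 'a \<Rightarrow> 'a \<Rightarrow> 'a \<Rightarrow> bool" where
  "is_pullback C f g p q \<longleftrightarrow> f \<in> Arr C \<and> g \<in> Arr C \<and> Cod C f = Cod C g \<and>
     in_hom C p (Dom C p) (Dom C f) \<and> in_hom C q (Dom C p) (Dom C g) \<and>
     f \<cdot>\<^bsub>C\<^esub> p = g \<cdot>\<^bsub>C\<^esub> q \<and>
     (\<forall>X x y. in_hom C x X (Dom C f) \<and> in_hom C y X (Dom C g) \<and> f \<cdot>\<^bsub>C\<^esub> x = g \<cdot>\<^bsub>C\<^esub> y \<longrightarrow>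
        (\<exists>!h. in_hom C h X (Dom C p) \<and> p \<cdot>\<^bsub>C\<^esub> h = x \<and> q \<cdot>\<^bsub>C\<^esub> h = y))"


section \<open>Factorisation systems\<close>

definition orthogonal :: "('o, 'a, 'z) cat_scheme \<Rightarrow> 'a \<Rightarrow> 'a \<Rightarrow> bool" where
  "orthogonal C e m \<longleftrightarrow>
     (\<forall>u v. in_hom C u (Dom C e) (Dom C m) \<and> in_hom C v (Cod C e) (Cod C m) \<and>
            m \<cdot>\<^bsub>C\<^esub> u = v \<cdot>\<^bsub>C\<^esub> e \<longrightarrow>
        (\<exists>!d. in_hom C d (Cod C e) (Dom C m) \<and> d \<cdot>\<^bsub>C\<^esub> e = u \<and> m \<cdot>\<^bsub>C\<^esub> d = v))"

definition is_factorisation ::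
  "('o, 'a, 'z) cat_scheme \<Rightarrow> 'a set \<Rightarrow> 'a set \<Rightarrow> 'a \<Rightarrow> 'a \<Rightarrow> 'a \<Rightarrow> bool" where
  "is_factorisation C E M f e m \<longleftrightarrow>
     e \<in> E \<and> m \<in> M \<and> Cod C e = Dom C m \<and> m \<cdot>\<^bsub>C\<^esub> e = f"

definition orthogonal_factorisation_system ::
  "('o, 'a, 'z) cat_scheme \<Rightarrow> 'a set \<Rightarrow> 'a set \<Rightarrow> bool" where
  "orthogonal_factorisation_system C E M \<longleftrightarrow>
     E = {e \<in> Arr C. \<forall>m\<in>M. orthogonal C e m} \<and>
     M = {m \<in> Arr C. \<forall>e\<in>E. orthogonal C e m} \<and>
     (\<forall>f\<in>Arr C. \<exists>e m. is_factorisation C E M f e m)"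

definition stable_under_pullback :: "('o, 'a, 'z) cat_scheme \<Rightarrow> 'a set \<Rightarrow> bool" where
  "stable_under_pullback C E \<longleftrightarrow> (\<forall>f e p q. e \<in> E \<and> is_pullback C f e p q \<longrightarrow> p \<in> E)"

definition stable_factorisation_system ::
  "('o, 'a, 'z) cat_scheme \<Rightarrow> 'a set \<Rightarrow> 'a set \<Rightarrow> bool" where
  "stable_factorisation_system C E M \<longleftrightarrow>
     orthogonal_factorisation_system C E M \<and> stable_under_pullback C E"

definition proper_factorisation_system ::
  "('o, 'a, 'z) cat_scheme \<Rightarrow> 'a set \<Rightarrow> 'a set \<Rightarrow> bool" where
  "proper_factorisation_system C E M \<longleftrightarrow>
     orthogonal_factorisation_system C E M \<and> (\<forall>e\<in>E. is_epi C e) \<and> (\<forall>m\<in>M. is_mono C m)"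


section \<open>Pseudo double categories\<close>

text \<open>\<open>VCat\<close> is the category of objects and vertical arrows, \<open>HCat\<close> the category of horizontal
  arrows and cells.  Horizontal composition is written in diagrammatic order.\<close>

record ('o, 'v, 'h, 'c) dblcat =
  VCat :: "('o, 'v) cat"
  HCat :: "('h, 'c) cat"
  Src :: "('h, 'c, 'o, 'v) ftor"
  Tgt :: "('h, 'c, 'o, 'v) ftor"
  HId :: "('o, 'v, 'h, 'c) ftor"
  HComp :: "'h \<Rightarrow> 'h \<Rightarrow> 'h"  (infixl \<open>\<odot>\<index>\<close> 70)
  CComp :: "'c \<Rightarrow> 'c \<Rightarrow> 'c"  (infixl \<open>\<boxdot>\<index>\<close> 70)
  HAssoc :: "'h \<Rightarrow> 'h \<Rightarrow> 'h \<Rightarrow> 'c"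
  LUnit :: "'h \<Rightarrow> 'c"
  RUnit :: "'h \<Rightarrow> 'c"

abbreviation HArrows :: "('o, 'v, 'h, 'c, 'z) dblcat_scheme \<Rightarrow> 'h set" where
  "HArrows D \<equiv> Obj (HCat D)"

abbreviation Cells :: "('o, 'v, 'h, 'c, 'z) dblcat_scheme \<Rightarrow> 'c set" where
  "Cells D \<equiv> Arr (HCat D)"

definition h_composable :: "('o, 'v, 'h, 'c, 'z) dblcat_scheme \<Rightarrow> 'h \<Rightarrow> 'h \<Rightarrow> bool" where
  "h_composable D p q \<longleftrightarrow> p \<in> HArrows D \<and> q \<in> HArrows D \<and> FObj (Tgt D) p = FObj (Src D) q"

definition c_composable :: "('o, 'v, 'h, 'c, 'z) dblcat_scheme \<Rightarrow> 'c \<Rightarrow> 'c \<Rightarrow> bool" where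
  "c_composable D \<alpha> \<beta> \<longleftrightarrow> \<alpha> \<in> Cells D \<and> \<beta> \<in> Cells D \<and> FArr (Tgt D) \<alpha> = FArr (Src D) \<beta>"

definition globular_iso ::
  "('o, 'v, 'h, 'c, 'z) dblcat_scheme \<Rightarrow> 'c \<Rightarrow> 'h \<Rightarrow> 'h \<Rightarrow> bool" where
  "globular_iso D \<alpha> p q \<longleftrightarrow> in_hom (HCat D) \<alpha> p q \<and> is_iso (HCat D) \<alpha> \<and>
     FArr (Src D) \<alpha> = Idn (VCat D) (FObj (Src D) p) \<and>
     FArr (Tgt D) \<alpha> = Idn (VCat D) (FObj (Tgt D) p)"

locale double_category =
  fixes D :: "('o, 'v, 'h, 'c, 'z) dblcat_scheme" (structure)
  assumes VCat_category: "category (VCat D)"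
    and HCat_category: "category (HCat D)"
    and Src_functor: "is_functor (HCat D) (VCat D) (Src D)"
    and Tgt_functor: "is_functor (HCat D) (VCat D) (Tgt D)"
    and HId_functor: "is_functor (VCat D) (HCat D) (HId D)"
    and Src_HId: "A \<in> Obj (VCat D) \<Longrightarrow> FObj (Src D) (FObj (HId D) A) = A"
    and Tgt_HId: "A \<in> Obj (VCat D) \<Longrightarrow> FObj (Tgt D) (FObj (HId D) A) = A"
    and Src_HId_arr: "f \<in> Arr (VCat D) \<Longrightarrow> FArr (Src D) (FArr (HId D) f) = f"
    and Tgt_HId_arr: "f \<in> Arr (VCat D) \<Longrightarrow> FArr (Tgt D) (FArr (HId D) f) = f"
    \<comment> \<open>horizontal composition is a functor on the pullback of \<open>Tgt\<close> and \<open>Src\<close>\<close>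
    and HComp_closed: "h_composable D p q \<Longrightarrow> p \<odot> q \<in> HArrows D"
    and Src_HComp: "h_composable D p q \<Longrightarrow> FObj (Src D) (p \<odot> q) = FObj (Src D) p"
    and Tgt_HComp: "h_composable D p q \<Longrightarrow> FObj (Tgt D) (p \<odot> q) = FObj (Tgt D) q"
    and CComp_hom: "\<lbrakk>c_composable D \<alpha> \<beta>; in_hom (HCat D) \<alpha> p p'; in_hom (HCat D) \<beta> q q'\<rbrakk>
                    \<Longrightarrow> in_hom (HCat D) (\<alpha> \<boxdot> \<beta>) (p \<odot> q) (p' \<odot> q')"
    and Src_CComp: "c_composable D \<alpha> \<beta> \<Longrightarrow> FArr (Src D) (\<alpha> \<boxdot> \<beta>) = FArr (Src D) \<alpha>"
    and Tgt_CComp: "c_composable D \<alpha> \<beta> \<Longrightarrow> FArr (Tgt D) (\<alpha> \<boxdot> \<beta>) = FArr (Tgt D) \<beta>"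
    and CComp_Idn: "h_composable D p q \<Longrightarrow>
          Idn (HCat D) p \<boxdot> Idn (HCat D) q = Idn (HCat D) (p \<odot> q)"
    and interchange:
          "\<lbrakk>c_composable D \<alpha> \<beta>; c_composable D \<alpha>' \<beta>';
            Cod (HCat D) \<alpha> = Dom (HCat D) \<alpha>'; Cod (HCat D) \<beta> = Dom (HCat D) \<beta>'\<rbrakk> \<Longrightarrow>
           (\<alpha>' \<cdot>\<^bsub>HCat D\<^esub> \<alpha>) \<boxdot> (\<beta>' \<cdot>\<^bsub>HCat D\<^esub> \<beta>) = (\<alpha>' \<boxdot> \<beta>') \<cdot>\<^bsub>HCat D\<^esub> (\<alpha> \<boxdot> \<beta>)"
    \<comment> \<open>associativity and unit constraints\<close>
    and HAssoc_iso: "\<lbrakk>h_composable D p q; h_composable D q r\<rbrakk> \<Longrightarrow>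
          globular_iso D (HAssoc D p q r) (p \<odot> q \<odot> r) (p \<odot> (q \<odot> r))"
    and LUnit_iso: "p \<in> HArrows D \<Longrightarrow>
          globular_iso D (LUnit D p) (FObj (HId D) (FObj (Src D) p) \<odot> p) p"
    and RUnit_iso: "p \<in> HArrows D \<Longrightarrow>
          globular_iso D (RUnit D p) (p \<odot> FObj (HId D) (FObj (Tgt D) p)) p"
    and HAssoc_natural:
          "\<lbrakk>c_composable D \<alpha> \<beta>; c_composable D \<beta> \<gamma>; in_hom (HCat D) \<alpha> p p';
            in_hom (HCat D) \<beta> q q'; in_hom (HCat D) \<gamma> r r'\<rbrakk> \<Longrightarrow>
           HAssoc D p' q' r' \<cdot>\<^bsub>HCat D\<^esub> (\<alpha> \<boxdot> \<beta> \<boxdot> \<gamma>) = (\<alpha> \<boxdot> (\<beta> \<boxdot> \<gamma>)) \<cdot>\<^bsub>HCat D\<^esub> HAssoc D p q r"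
    and LUnit_natural: "in_hom (HCat D) \<alpha> p p' \<Longrightarrow>
          LUnit D p' \<cdot>\<^bsub>HCat D\<^esub> (FArr (HId D) (FArr (Src D) \<alpha>) \<boxdot> \<alpha>) = \<alpha> \<cdot>\<^bsub>HCat D\<^esub> LUnit D p"
    and RUnit_natural: "in_hom (HCat D) \<alpha> p p' \<Longrightarrow>
          RUnit D p' \<cdot>\<^bsub>HCat D\<^esub> (\<alpha> \<boxdot> FArr (HId D) (FArr (Tgt D) \<alpha>)) = \<alpha> \<cdot>\<^bsub>HCat D\<^esub> RUnit D p"
    and pentagon:
          "\<lbrakk>h_composable D p q; h_composable D q r; h_composable D r s\<rbrakk> \<Longrightarrow>
           HAssoc D p q (r \<odot> s) \<cdot>\<^bsub>HCat D\<^esub> HAssoc D (p \<odot> q) r s =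
           (Idn (HCat D) p \<boxdot> HAssoc D q r s) \<cdot>\<^bsub>HCat D\<^esub> HAssoc D p (q \<odot> r) s
             \<cdot>\<^bsub>HCat D\<^esub> (HAssoc D p q r \<boxdot> Idn (HCat D) s)"
    and triangle: "h_composable D p q \<Longrightarrow>
           (Idn (HCat D) p \<boxdot> LUnit D q) \<cdot>\<^bsub>HCat D\<^esub> HAssoc D p (FObj (HId D) (FObj (Tgt D) p)) q =
           RUnit D p \<boxdot> Idn (HCat D) q"


subsection \<open>Local orders\<close>

definition locally_preordered :: "('o, 'v, 'h, 'c, 'z) dblcat_scheme \<Rightarrow> bool" where
  "locally_preordered D \<longleftrightarrow>
     (\<forall>p q f g \<alpha> \<beta>. in_hom (HCat D) \<alpha> p q \<and> FArr (Src D) \<alpha> = f \<and> FArr (Tgt D) \<alpha> = g \<and>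
                     in_hom (HCat D) \<beta> p q \<and> FArr (Src D) \<beta> = f \<and> FArr (Tgt D) \<beta> = g
        \<longrightarrow> \<alpha> = \<beta>)"

text \<open>The hom-category from \<open>A\<close> to \<open>B\<close> of the vertical 2-category: its composition is horizontal
  composition of cells, corrected by the unit constraints of \<open>A\<close> and \<open>B\<close>.\<close>

definition vertical_hom_category ::
  "('o, 'v, 'h, 'c, 'z) dblcat_scheme \<Rightarrow> 'o \<Rightarrow> 'o \<Rightarrow> ('v, 'c) cat" where
  "vertical_hom_category D A B =
     \<lparr>Obj = {f. in_hom (VCat D) f A B},
      Arr = {\<alpha>. in_hom (HCat D) \<alpha> (FObj (HId D) A) (FObj (HId D) B)},
      Dom = FArr (Src D),
      Cod = FArr (Tgt D),
      Idn = FArr (HId D),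
      Cmp = (\<lambda>\<beta> \<alpha>. LUnit D (FObj (HId D) B) \<cdot>\<^bsub>HCat D\<^esub> (\<alpha> \<boxdot>\<^bsub>D\<^esub> \<beta>)
                     \<cdot>\<^bsub>HCat D\<^esub> the_inverse (HCat D) (LUnit D (FObj (HId D) A)))\<rparr>"

definition poset_category :: "('o, 'a, 'z) cat_scheme \<Rightarrow> bool" where
  "poset_category C \<longleftrightarrow>
     (\<forall>x y f g. in_hom C f x y \<and> in_hom C g x y \<longrightarrow> f = g) \<and>
     (\<forall>x y f g. in_hom C f x y \<and> in_hom C g y x \<longrightarrow> x = y)"

definition locally_posetal :: "('o, 'v, 'h, 'c, 'z) dblcat_scheme \<Rightarrow> bool" where
  "locally_posetal D \<longleftrightarrow> locally_preordered D \<and>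
     (\<forall>A\<in>Obj (VCat D). \<forall>B\<in>Obj (VCat D). poset_category (vertical_hom_category D A B))"


subsection \<open>Equivalence of double categories\<close>

text \<open>The comparison cells of a pseudo double functor \<open>F\<close> are
  \<open>DComp F p q : F p \<odot> F q \<rightarrow> F (p \<odot> q)\<close> and \<open>DUnit F A : Id (F A) \<rightarrow> F (Id A)\<close>.\<close>

record ('o, 'v, 'h, 'c, 'p, 'w, 'k, 'd) dftor =
  DF0 :: "('o, 'v, 'p, 'w) ftor"
  DF1 :: "('h, 'c, 'k, 'd) ftor"
  DComp :: "'h \<Rightarrow> 'h \<Rightarrow> 'd"
  DUnit :: "'o \<Rightarrow> 'd"

locale pseudo_double_functor =
  fixes D :: "('o, 'v, 'h, 'c, 'z) dblcat_scheme"
    and K :: "('p, 'w, 'k, 'd, 'y) dblcat_scheme"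
    and F :: "('o, 'v, 'h, 'c, 'p, 'w, 'k, 'd) dftor"
  assumes DF0_functor: "is_functor (VCat D) (VCat K) (DF0 F)"
    and DF1_functor: "is_functor (HCat D) (HCat K) (DF1 F)"
    and DF_Src: "p \<in> HArrows D \<Longrightarrow> FObj (Src K) (FObj (DF1 F) p) = FObj (DF0 F) (FObj (Src D) p)"
    and DF_Tgt: "p \<in> HArrows D \<Longrightarrow> FObj (Tgt K) (FObj (DF1 F) p) = FObj (DF0 F) (FObj (Tgt D) p)"
    and DF_Src_arr: "\<alpha> \<in> Cells D \<Longrightarrow> FArr (Src K) (FArr (DF1 F) \<alpha>) = FArr (DF0 F) (FArr (Src D) \<alpha>)"
    and DF_Tgt_arr: "\<alpha> \<in> Cells D \<Longrightarrow> FArr (Tgt K) (FArr (DF1 F) \<alpha>) = FArr (DF0 F) (FArr (Tgt D) \<alpha>)"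
    and DComp_iso: "h_composable D p q \<Longrightarrow>
          globular_iso K (DComp F p q) (FObj (DF1 F) p \<odot>\<^bsub>K\<^esub> FObj (DF1 F) q)
            (FObj (DF1 F) (p \<odot>\<^bsub>D\<^esub> q))"
    and DUnit_iso: "A \<in> Obj (VCat D) \<Longrightarrow>
          globular_iso K (DUnit F A) (FObj (HId K) (FObj (DF0 F) A))
            (FObj (DF1 F) (FObj (HId D) A))"
    and DComp_natural:
          "\<lbrakk>c_composable D \<alpha> \<beta>; in_hom (HCat D) \<alpha> p p'; in_hom (HCat D) \<beta> q q'\<rbrakk> \<Longrightarrow>
           FArr (DF1 F) (\<alpha> \<boxdot>\<^bsub>D\<^esub> \<beta>) \<cdot>\<^bsub>HCat K\<^esub> DComp F p q =
           DComp F p' q' \<cdot>\<^bsub>HCat K\<^esub> (FArr (DF1 F) \<alpha> \<boxdot>\<^bsub>K\<^esub> FArr (DF1 F) \<beta>)"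
    and DUnit_natural: "in_hom (VCat D) f A B \<Longrightarrow>
          FArr (DF1 F) (FArr (HId D) f) \<cdot>\<^bsub>HCat K\<^esub> DUnit F A =
          DUnit F B \<cdot>\<^bsub>HCat K\<^esub> FArr (HId K) (FArr (DF0 F) f)"
    and DF_assoc: "\<lbrakk>h_composable D p q; h_composable D q r\<rbrakk> \<Longrightarrow>
          FArr (DF1 F) (HAssoc D p q r) \<cdot>\<^bsub>HCat K\<^esub> DComp F (p \<odot>\<^bsub>D\<^esub> q) r
            \<cdot>\<^bsub>HCat K\<^esub> (DComp F p q \<boxdot>\<^bsub>K\<^esub> Idn (HCat K) (FObj (DF1 F) r)) =
          DComp F p (q \<odot>\<^bsub>D\<^esub> r) \<cdot>\<^bsub>HCat K\<^esub> (Idn (HCat K) (FObj (DF1 F) p) \<boxdot>\<^bsub>K\<^esub> DComp F q r)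
            \<cdot>\<^bsub>HCat K\<^esub> HAssoc K (FObj (DF1 F) p) (FObj (DF1 F) q) (FObj (DF1 F) r)"
    and DF_lunit: "p \<in> HArrows D \<Longrightarrow>
          FArr (DF1 F) (LUnit D p) \<cdot>\<^bsub>HCat K\<^esub> DComp F (FObj (HId D) (FObj (Src D) p)) p
            \<cdot>\<^bsub>HCat K\<^esub> (DUnit F (FObj (Src D) p) \<boxdot>\<^bsub>K\<^esub> Idn (HCat K) (FObj (DF1 F) p)) =
          LUnit K (FObj (DF1 F) p)"
    and DF_runit: "p \<in> HArrows D \<Longrightarrow>
          FArr (DF1 F) (RUnit D p) \<cdot>\<^bsub>HCat K\<^esub> DComp F p (FObj (HId D) (FObj (Tgt D) p))
            \<cdot>\<^bsub>HCat K\<^esub> (Idn (HCat K) (FObj (DF1 F) p) \<boxdot>\<^bsub>K\<^esub> DUnit F (FObj (Tgt D) p)) =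
          RUnit K (FObj (DF1 F) p)"

definition id_dftor ::
  "('o, 'v, 'h, 'c, 'z) dblcat_scheme \<Rightarrow> ('o, 'v, 'h, 'c, 'o, 'v, 'h, 'c) dftor" where
  "id_dftor D = \<lparr>DF0 = id_ftor, DF1 = id_ftor,
     DComp = \<lambda>p q. Idn (HCat D) (p \<odot>\<^bsub>D\<^esub> q), DUnit = \<lambda>A. Idn (HCat D) (FObj (HId D) A)\<rparr>"

text \<open>\<open>comp_dftor L G F\<close> is \<open>G\<close> after \<open>F\<close>, where \<open>L\<close> is the codomain of \<open>G\<close>.\<close>

definition comp_dftor ::
  "('q, 'x, 'l, 'e, 'y) dblcat_scheme \<Rightarrow> ('p, 'w, 'k, 'd, 'q, 'x, 'l, 'e) dftor \<Rightarrow>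
   ('o, 'v, 'h, 'c, 'p, 'w, 'k, 'd) dftor \<Rightarrow> ('o, 'v, 'h, 'c, 'q, 'x, 'l, 'e) dftor" where
  "comp_dftor L G F = \<lparr>DF0 = comp_ftor (DF0 G) (DF0 F), DF1 = comp_ftor (DF1 G) (DF1 F),
     DComp = \<lambda>p q. FArr (DF1 G) (DComp F p q)
                     \<cdot>\<^bsub>HCat L\<^esub> DComp G (FObj (DF1 F) p) (FObj (DF1 F) q),
     DUnit = \<lambda>A. FArr (DF1 G) (DUnit F A) \<cdot>\<^bsub>HCat L\<^esub> DUnit G (FObj (DF0 F) A)\<rparr>"

record ('o, 'h, 'w, 'd) vtrans =
  VT0 :: "'o \<Rightarrow> 'w"
  VT1 :: "'h \<Rightarrow> 'd"

locale vertical_transformation =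
  fixes D :: "('o, 'v, 'h, 'c, 'z) dblcat_scheme"
    and K :: "('p, 'w, 'k, 'd, 'y) dblcat_scheme"
    and F :: "('o, 'v, 'h, 'c, 'p, 'w, 'k, 'd) dftor"
    and G :: "('o, 'v, 'h, 'c, 'p, 'w, 'k, 'd) dftor"
    and \<tau> :: "('o, 'h, 'w, 'd) vtrans"
  assumes VT0_natural: "natural_transformation (VCat D) (VCat K) (DF0 F) (DF0 G) (VT0 \<tau>)"
    and VT1_natural: "natural_transformation (HCat D) (HCat K) (DF1 F) (DF1 G) (VT1 \<tau>)"
    and VT_Src: "p \<in> HArrows D \<Longrightarrow> FArr (Src K) (VT1 \<tau> p) = VT0 \<tau> (FObj (Src D) p)"
    and VT_Tgt: "p \<in> HArrows D \<Longrightarrow> FArr (Tgt K) (VT1 \<tau> p) = VT0 \<tau> (FObj (Tgt D) p)"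
    and VT_HComp: "h_composable D p q \<Longrightarrow>
          VT1 \<tau> (p \<odot>\<^bsub>D\<^esub> q) \<cdot>\<^bsub>HCat K\<^esub> DComp F p q = DComp G p q \<cdot>\<^bsub>HCat K\<^esub> (VT1 \<tau> p \<boxdot>\<^bsub>K\<^esub> VT1 \<tau> q)"
    and VT_HId: "A \<in> Obj (VCat D) \<Longrightarrow>
          VT1 \<tau> (FObj (HId D) A) \<cdot>\<^bsub>HCat K\<^esub> DUnit F A = DUnit G A \<cdot>\<^bsub>HCat K\<^esub> FArr (HId K) (VT0 \<tau> A)"

definition invertible_vertical_transformation ::
  "('o, 'v, 'h, 'c, 'z) dblcat_scheme \<Rightarrow> ('p, 'w, 'k, 'd, 'y) dblcat_scheme \<Rightarrow>
   ('o, 'v, 'h, 'c, 'p, 'w, 'k, 'd) dftor \<Rightarrow> ('o, 'v, 'h, 'c, 'p, 'w, 'k, 'd) dftor \<Rightarrow>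
   ('o, 'h, 'w, 'd) vtrans \<Rightarrow> bool" where
  "invertible_vertical_transformation D K F G \<tau> \<longleftrightarrow> vertical_transformation D K F G \<tau> \<and>
     (\<exists>\<sigma>. vertical_transformation D K G F \<sigma> \<and>
        (\<forall>A\<in>Obj (VCat D). VT0 \<sigma> A \<cdot>\<^bsub>VCat K\<^esub> VT0 \<tau> A = Idn (VCat K) (FObj (DF0 F) A) \<and>
                           VT0 \<tau> A \<cdot>\<^bsub>VCat K\<^esub> VT0 \<sigma> A = Idn (VCat K) (FObj (DF0 G) A)) \<and>
        (\<forall>p\<in>HArrows D. VT1 \<sigma> p \<cdot>\<^bsub>HCat K\<^esub> VT1 \<tau> p = Idn (HCat K) (FObj (DF1 F) p) \<and>
                         VT1 \<tau> p \<cdot>\<^bsub>HCat K\<^esub> VT1 \<sigma> p = Idn (HCat K) (FObj (DF1 G) p)))"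

definition double_equivalence ::
  "('o, 'v, 'h, 'c, 'z) dblcat_scheme \<Rightarrow> ('p, 'w, 'k, 'd, 'y) dblcat_scheme \<Rightarrow>
   ('o, 'v, 'h, 'c, 'p, 'w, 'k, 'd) dftor \<Rightarrow> bool" where
  "double_equivalence D K F \<longleftrightarrow> pseudo_double_functor D K F \<and>
     (\<exists>G \<eta> \<epsilon>. pseudo_double_functor K D G \<and>
        invertible_vertical_transformation D D (id_dftor D) (comp_dftor D G F) \<eta> \<and>
        invertible_vertical_transformation K K (comp_dftor K F G) (id_dftor K) \<epsilon>)"


section \<open>The double category of relations\<close>

text \<open>Products, pullbacks and factorisations are chosen arbitrarily; different choices give
  isomorphic double categories.\<close>

definition proj :: "('o, 'a, 'z) cat_scheme \<Rightarrow> 'o \<Rightarrow> 'o \<Rightarrow> 'a \<times> 'a" where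
  "proj C A B = (SOME (p, q). is_product C A B p q)"

definition proj1 :: "('o, 'a, 'z) cat_scheme \<Rightarrow> 'o \<Rightarrow> 'o \<Rightarrow> 'a" where
  "proj1 C A B = fst (proj C A B)"

definition proj2 :: "('o, 'a, 'z) cat_scheme \<Rightarrow> 'o \<Rightarrow> 'o \<Rightarrow> 'a" where
  "proj2 C A B = snd (proj C A B)"

definition prod_obj :: "('o, 'a, 'z) cat_scheme \<Rightarrow> 'o \<Rightarrow> 'o \<Rightarrow> 'o" where
  "prod_obj C A B = Dom C (proj1 C A B)"

definition pairing :: "('o, 'a, 'z) cat_scheme \<Rightarrow> 'a \<Rightarrow> 'a \<Rightarrow> 'a" where
  "pairing C f g = (THE h. in_hom C h (Dom C f) (prod_obj C (Cod C f) (Cod C g)) \<and>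
     proj1 C (Cod C f) (Cod C g) \<cdot>\<^bsub>C\<^esub> h = f \<and> proj2 C (Cod C f) (Cod C g) \<cdot>\<^bsub>C\<^esub> h = g)"

definition prod_arr :: "('o, 'a, 'z) cat_scheme \<Rightarrow> 'a \<Rightarrow> 'a \<Rightarrow> 'a" where
  "prod_arr C f g = pairing C (f \<cdot>\<^bsub>C\<^esub> proj1 C (Dom C f) (Dom C g))
                              (g \<cdot>\<^bsub>C\<^esub> proj2 C (Dom C f) (Dom C g))"

definition pb :: "('o, 'a, 'z) cat_scheme \<Rightarrow> 'a \<Rightarrow> 'a \<Rightarrow> 'a \<times> 'a" where
  "pb C f g = (SOME (p, q). is_pullback C f g p q)"

definition pb_pairing :: "('o, 'a, 'z) cat_scheme \<Rightarrow> 'a \<Rightarrow> 'a \<Rightarrow> 'a \<Rightarrow> 'a \<Rightarrow> 'a" where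
  "pb_pairing C f g x y = (THE h. in_hom C h (Dom C x) (Dom C (fst (pb C f g))) \<and>
     fst (pb C f g) \<cdot>\<^bsub>C\<^esub> h = x \<and> snd (pb C f g) \<cdot>\<^bsub>C\<^esub> h = y)"

definition fact :: "('o, 'a, 'z) cat_scheme \<Rightarrow> 'a set \<Rightarrow> 'a set \<Rightarrow> 'a \<Rightarrow> 'a \<times> 'a" where
  "fact C E M f = (SOME (e, m). is_factorisation C E M f e m)"

definition Epart :: "('o, 'a, 'z) cat_scheme \<Rightarrow> 'a set \<Rightarrow> 'a set \<Rightarrow> 'a \<Rightarrow> 'a" where
  "Epart C E M f = fst (fact C E M f)"

definition Mpart :: "('o, 'a, 'z) cat_scheme \<Rightarrow> 'a set \<Rightarrow> 'a set \<Rightarrow> 'a \<Rightarrow> 'a" where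
  "Mpart C E M f = snd (fact C E M f)"

record ('o, 'a) hrel =
  left_obj :: 'o
  right_obj :: 'o
  rel_arr :: 'a

record ('o, 'a) rel_cell =
  cell_dom :: "('o, 'a) hrel"
  cell_cod :: "('o, 'a) hrel"
  cell_left :: 'a
  cell_right :: 'a
  cell_arr :: 'a

context
  fixes C :: "('o, 'a, 'z) cat_scheme" and E M :: "'a set"
begin

definition is_rel :: "('o, 'a) hrel \<Rightarrow> bool" where
  "is_rel R \<longleftrightarrow> left_obj R \<in> Obj C \<and> right_obj R \<in> Obj C \<and> rel_arr R \<in> M \<and> rel_arr R \<in> Arr C \<and>
     Cod C (rel_arr R) = prod_obj C (left_obj R) (right_obj R)"

definition apex :: "('o, 'a) hrel \<Rightarrow> 'o" where
  "apex R = Dom C (rel_arr R)"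

definition lleg :: "('o, 'a) hrel \<Rightarrow> 'a" where
  "lleg R = proj1 C (left_obj R) (right_obj R) \<cdot>\<^bsub>C\<^esub> rel_arr R"

definition rleg :: "('o, 'a) hrel \<Rightarrow> 'a" where
  "rleg R = proj2 C (left_obj R) (right_obj R) \<cdot>\<^bsub>C\<^esub> rel_arr R"

definition is_rel_cell :: "('o, 'a) rel_cell \<Rightarrow> bool" where
  "is_rel_cell \<alpha> \<longleftrightarrow> is_rel (cell_dom \<alpha>) \<and> is_rel (cell_cod \<alpha>) \<and>
     in_hom C (cell_left \<alpha>) (left_obj (cell_dom \<alpha>)) (left_obj (cell_cod \<alpha>)) \<and>
     in_hom C (cell_right \<alpha>) (right_obj (cell_dom \<alpha>)) (right_obj (cell_cod \<alpha>)) \<and>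
     in_hom C (cell_arr \<alpha>) (apex (cell_dom \<alpha>)) (apex (cell_cod \<alpha>)) \<and>
     rel_arr (cell_cod \<alpha>) \<cdot>\<^bsub>C\<^esub> cell_arr \<alpha> =
       prod_arr C (cell_left \<alpha>) (cell_right \<alpha>) \<cdot>\<^bsub>C\<^esub> rel_arr (cell_dom \<alpha>)"

definition rel_hcat :: "(('o, 'a) hrel, ('o, 'a) rel_cell) cat" where
  "rel_hcat =
     \<lparr>Obj = {R. is_rel R},
      Arr = {\<alpha>. is_rel_cell \<alpha>},
      Dom = cell_dom,
      Cod = cell_cod,
      Idn = (\<lambda>R. \<lparr>cell_dom = R, cell_cod = R, cell_left = Idn C (left_obj R),
                  cell_right = Idn C (right_obj R), cell_arr = Idn C (apex R)\<rparr>),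
      Cmp = (\<lambda>\<beta> \<alpha>. \<lparr>cell_dom = cell_dom \<alpha>, cell_cod = cell_cod \<beta>,
                    cell_left = cell_left \<beta> \<cdot>\<^bsub>C\<^esub> cell_left \<alpha>,
                    cell_right = cell_right \<beta> \<cdot>\<^bsub>C\<^esub> cell_right \<alpha>,
                    cell_arr = cell_arr \<beta> \<cdot>\<^bsub>C\<^esub> cell_arr \<alpha>\<rparr>)\<rparr>"

definition diagonal :: "'o \<Rightarrow> 'a" where
  "diagonal A = pairing C (Idn C A) (Idn C A)"

definition rel_id :: "'o \<Rightarrow> ('o, 'a) hrel" where
  "rel_id A = \<lparr>left_obj = A, right_obj = A, rel_arr = Mpart C E M (diagonal A)\<rparr>"

definition id_cover :: "'o \<Rightarrow> 'a" where
  "id_cover A = Epart C E M (diagonal A)"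

definition rel_id_cell :: "'a \<Rightarrow> ('o, 'a) rel_cell" where
  "rel_id_cell f = \<lparr>cell_dom = rel_id (Dom C f), cell_cod = rel_id (Cod C f),
     cell_left = f, cell_right = f,
     cell_arr = (THE d. in_hom C d (apex (rel_id (Dom C f))) (apex (rel_id (Cod C f))) \<and>
        rel_arr (rel_id (Cod C f)) \<cdot>\<^bsub>C\<^esub> d = prod_arr C f f \<cdot>\<^bsub>C\<^esub> rel_arr (rel_id (Dom C f)) \<and>
        d \<cdot>\<^bsub>C\<^esub> id_cover (Dom C f) = id_cover (Cod C f) \<cdot>\<^bsub>C\<^esub> f)\<rparr>"

text \<open>The span \<open>R \<times>\<^sub>B S \<rightarrow> A \<times> C\<close>, whose factorisation gives the composite relation.\<close>

definition rel_span :: "('o, 'a) hrel \<Rightarrow> ('o, 'a) hrel \<Rightarrow> 'a" where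
  "rel_span R S = pairing C (lleg R \<cdot>\<^bsub>C\<^esub> fst (pb C (rleg R) (lleg S)))
                            (rleg S \<cdot>\<^bsub>C\<^esub> snd (pb C (rleg R) (lleg S)))"

definition rel_comp :: "('o, 'a) hrel \<Rightarrow> ('o, 'a) hrel \<Rightarrow> ('o, 'a) hrel" where
  "rel_comp R S = \<lparr>left_obj = left_obj R, right_obj = right_obj S,
     rel_arr = Mpart C E M (rel_span R S)\<rparr>"

text \<open>For \<open>x : X \<rightarrow> R\<close> and \<open>y : X \<rightarrow> S\<close> agreeing over \<open>B\<close>, the induced arrow
  \<open>X \<rightarrow> R \<times>\<^sub>B S \<rightarrow> rel_comp R S\<close>.  These generalised elements describe the action on
  cells and the coherence isomorphisms.\<close>

definition rel_elem :: "('o, 'a) hrel \<Rightarrow> ('o, 'a) hrel \<Rightarrow> 'a \<Rightarrow> 'a \<Rightarrow> 'a" where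
  "rel_elem R S x y = Epart C E M (rel_span R S) \<cdot>\<^bsub>C\<^esub> pb_pairing C (rleg R) (lleg S) x y"

definition rel_cell_comp :: "('o, 'a) rel_cell \<Rightarrow> ('o, 'a) rel_cell \<Rightarrow> ('o, 'a) rel_cell" where
  "rel_cell_comp \<alpha> \<beta> =
     (let R = cell_dom \<alpha>; S = cell_dom \<beta>; R' = cell_cod \<alpha>; S' = cell_cod \<beta>;
          p = fst (pb C (rleg R) (lleg S)); q = snd (pb C (rleg R) (lleg S))
      in \<lparr>cell_dom = rel_comp R S, cell_cod = rel_comp R' S',
          cell_left = cell_left \<alpha>, cell_right = cell_right \<beta>,
          cell_arr = (THE d. in_hom C d (apex (rel_comp R S)) (apex (rel_comp R' S')) \<and>
             rel_arr (rel_comp R' S') \<cdot>\<^bsub>C\<^esub> d =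
               prod_arr C (cell_left \<alpha>) (cell_right \<beta>) \<cdot>\<^bsub>C\<^esub> rel_arr (rel_comp R S) \<and>
             d \<cdot>\<^bsub>C\<^esub> Epart C E M (rel_span R S) =
               rel_elem R' S' (cell_arr \<alpha> \<cdot>\<^bsub>C\<^esub> p) (cell_arr \<beta> \<cdot>\<^bsub>C\<^esub> q))\<rparr>)"

definition globular_cell :: "('o, 'a) hrel \<Rightarrow> ('o, 'a) hrel \<Rightarrow> 'a \<Rightarrow> ('o, 'a) rel_cell" where
  "globular_cell R S d = \<lparr>cell_dom = R, cell_cod = S, cell_left = Idn C (left_obj R),
     cell_right = Idn C (right_obj R), cell_arr = d\<rparr>"

text \<open>The associator is induced by the isomorphism
  \<open>(R \<times>\<^sub>B S) \<times>\<^sub>C T \<cong> R \<times>\<^sub>B (S \<times>\<^sub>C T)\<close>, i.e. sends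
  \<open>[[x, y], z]\<close> to \<open>[x, [y, z]]\<close>; the unitors are inverse to \<open>R \<cong> A \<times>\<^sub>A R \<rightarrow> Id \<odot> R\<close> and
  \<open>R \<cong> R \<times>\<^sub>B B \<rightarrow> R \<odot> Id\<close>.  Uniqueness holds because the arrows out of the
  iterated pullbacks are in \<open>E\<close> by stability.\<close>

definition rel_assoc ::
  "('o, 'a) hrel \<Rightarrow> ('o, 'a) hrel \<Rightarrow> ('o, 'a) hrel \<Rightarrow> ('o, 'a) rel_cell" where
  "rel_assoc R S T =
     (let P = rel_comp (rel_comp R S) T; Q = rel_comp R (rel_comp S T)
      in globular_cell P Q
           (THE d. in_hom C d (apex P) (apex Q) \<and> rel_arr Q \<cdot>\<^bsub>C\<^esub> d = rel_arr P \<and>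
              (\<forall>X x y z. in_hom C x X (apex R) \<and> in_hom C y X (apex S) \<and> in_hom C z X (apex T) \<and>
                 rleg R \<cdot>\<^bsub>C\<^esub> x = lleg S \<cdot>\<^bsub>C\<^esub> y \<and> rleg S \<cdot>\<^bsub>C\<^esub> y = lleg T \<cdot>\<^bsub>C\<^esub> z \<longrightarrow>
                 d \<cdot>\<^bsub>C\<^esub> rel_elem (rel_comp R S) T (rel_elem R S x y) z =
                 rel_elem R (rel_comp S T) x (rel_elem S T y z))))"

definition rel_lunit :: "('o, 'a) hrel \<Rightarrow> ('o, 'a) rel_cell" where
  "rel_lunit R =
     (let I = rel_id (left_obj R); P = rel_comp I R
      in globular_cell P R
           (THE d. in_hom C d (apex P) (apex R) \<and> rel_arr R \<cdot>\<^bsub>C\<^esub> d = rel_arr P \<and>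
              d \<cdot>\<^bsub>C\<^esub> rel_elem I R (id_cover (left_obj R) \<cdot>\<^bsub>C\<^esub> lleg R) (Idn C (apex R)) =
              Idn C (apex R)))"

definition rel_runit :: "('o, 'a) hrel \<Rightarrow> ('o, 'a) rel_cell" where
  "rel_runit R =
     (let I = rel_id (right_obj R); P = rel_comp R I
      in globular_cell P R
           (THE d. in_hom C d (apex P) (apex R) \<and> rel_arr R \<cdot>\<^bsub>C\<^esub> d = rel_arr P \<and>
              d \<cdot>\<^bsub>C\<^esub> rel_elem R I (Idn C (apex R)) (id_cover (right_obj R) \<cdot>\<^bsub>C\<^esub> rleg R) =
              Idn C (apex R)))"

end

definition Rel ::
  "('o, 'a) cat \<Rightarrow> 'a set \<Rightarrow> 'a set \<Rightarrow> ('o, 'a, ('o, 'a) hrel, ('o, 'a) rel_cell) dblcat" where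
  "Rel C E M =
     \<lparr>VCat = C,
      HCat = rel_hcat C M,
      Src = \<lparr>FObj = left_obj, FArr = cell_left\<rparr>,
      Tgt = \<lparr>FObj = right_obj, FArr = cell_right\<rparr>,
      HId = \<lparr>FObj = rel_id C E M, FArr = rel_id_cell C E M\<rparr>,
      HComp = rel_comp C E M,
      CComp = rel_cell_comp C E M,
      HAssoc = rel_assoc C E M,
      LUnit = rel_lunit C E M,
      RUnit = rel_runit C E M\<rparr>"

text \<open>\<open>F\<close> exhibits \<open>D\<close> as a double category of relations.\<close>

definition relations_presentation ::
  "('o, 'v, 'h, 'c) dblcat \<Rightarrow> ('p, 'a) cat \<Rightarrow> 'a set \<Rightarrow> 'a set \<Rightarrow>
   ('o, 'v, 'h, 'c, 'p, 'a, ('p, 'a) hrel, ('p, 'a) rel_cell) dftor \<Rightarrow> bool" where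
  "relations_presentation D C E M F \<longleftrightarrow>
     double_category D \<and> category C \<and> has_finite_limits C \<and> stable_factorisation_system C E M \<and>
     double_equivalence D (Rel C E M) F"

text \<open>The class of vertical arrows of \<open>D\<close> corresponding to a class of arrows of \<open>C\<close> under the
  equivalence \<open>DF0 F\<close>.  Classes belonging to a factorisation system are closed under isomorphism,
  so this preimage is the transported class.\<close>

definition accompanying_class ::
  "('o, 'v, 'h, 'c) dblcat \<Rightarrow> ('o, 'v, 'h, 'c, 'p, 'a, 'k, 'd) dftor \<Rightarrow> 'a set \<Rightarrow> 'v set" where
  "accompanying_class D F E = {f \<in> Arr (VCat D). FArr (DF0 F) f \<in> E}"

end

theory Submission
  imports Defs
begin

text \<open>Local posetality only concerns cells with given sides and unit horizontal arrows, so it is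
  reflected by pseudo double functors that are faithful on vertical arrows and on cells, and hence
  invariant under equivalence; properness is invariant as well.  So only \<open>Rel C E M\<close> has to be
  considered.  There, parallel cells with equal sides coincide iff every arrow of \<open>M\<close> is a
  monomorphism, since an arrow of \<open>M\<close> into \<open>Y\<close> is a relation from \<open>Y\<close> to the terminal object.  If
  \<open>e \<in> E\<close> and \<open>f e = g e\<close>, orthogonality of \<open>E\<close> and \<open>M\<close> yields cells \<open>f \<Rightarrow> g\<close> and \<open>g \<Rightarrow> f\<close> between
  identity relations; conversely, if \<open>E\<close> consists of epimorphisms, then the two legs of an identity
  relation agree, and a cell \<open>f \<Rightarrow> g\<close> forces \<open>f = g\<close>.\<close>

section \<open>Orthogonality\<close>

text \<open>The identity relation on \<open>A\<close> is the \<open>M\<close>-part of the diagonal,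
  not the diagonal itself, and this is where epimorphisms enter. A square from \<open>e\<close> to a
  diagonal \<open>Z \<rightarrow> Z \<times> Z\<close> is a pair \<open>f, g\<close> with
  \<open>f e = g e\<close>, and a filler exists exactly when \<open>f = g\<close>; so
  \<open>e\<close> is epi iff it is orthogonal to all diagonals. Hence \<open>E\<close> consists of
  epimorphisms iff every diagonal lies in \<open>M\<close>, that is, iff the cover
  \<open>I\<^sub>e A\<close> of each identity relation is invertible. Antisymmetry of unit cells
  detects exactly this. Invariance meets a different obstacle: objects and arrows of the relational
  side lie in the image of the equivalence only up to isomorphism, and pseudo double functors
  preserve units only up to \<open>DUnit\<close>. Arrows are therefore conjugated by the counit,
  which does not affect membership in \<open>E\<close> or \<open>M\<close>, and unit cells are
  conjugated by \<open>DUnit\<close>, which does not affect the sides of a cell.\<close>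

context category
begin

lemma Cmp_Arr: "\<lbrakk>f \<in> Arr C; g \<in> Arr C; Cod C f = Dom C g\<rbrakk> \<Longrightarrow> g \<cdot> f \<in> Arr C"
  using Cmp_hom by (auto simp: in_hom_def)

lemma Dom_Cmp: "\<lbrakk>f \<in> Arr C; g \<in> Arr C; Cod C f = Dom C g\<rbrakk> \<Longrightarrow> Dom C (g \<cdot> f) = Dom C f"
  using Cmp_hom by (auto simp: in_hom_def)

lemma Cod_Cmp: "\<lbrakk>f \<in> Arr C; g \<in> Arr C; Cod C f = Dom C g\<rbrakk> \<Longrightarrow> Cod C (g \<cdot> f) = Cod C g"
  using Cmp_hom by (auto simp: in_hom_def)

lemma Idn_Arr: "A \<in> Obj C \<Longrightarrow> Idn C A \<in> Arr C"
  and Dom_Idn: "A \<in> Obj C \<Longrightarrow> Dom C (Idn C A) = A"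
  and Cod_Idn: "A \<in> Obj C \<Longrightarrow> Cod C (Idn C A) = A"
  using Idn_hom by (auto simp: in_hom_def)

lemma Cmp_Idn_Dom: "\<lbrakk>f \<in> Arr C; Dom C f = X\<rbrakk> \<Longrightarrow> f \<cdot> Idn C X = f"
  and Cmp_Idn_Cod: "\<lbrakk>f \<in> Arr C; Cod C f = Y\<rbrakk> \<Longrightarrow> Idn C Y \<cdot> f = f"
  using Cmp_Idn_right Cmp_Idn_left by (auto simp: in_hom_def)

lemma Cmp_Cmp:
  "\<lbrakk>f \<in> Arr C; g \<in> Arr C; h \<in> Arr C; Cod C f = Dom C g; Cod C g = Dom C h\<rbrakk>
    \<Longrightarrow> (h \<cdot> g) \<cdot> f = h \<cdot> (g \<cdot> f)"
  using Cmp_assoc by (auto simp: in_hom_def)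

text \<open>A premise \<open>in_hom C f X Y\<close> contains objects that do not occur in the
  conclusion, so the simplifier could not instantiate it. With \<open>Arr\<close>,
  \<open>Dom\<close> and \<open>Cod\<close> in its place the typing conditions are discharged by
  rewriting, and \<open>Cmp_Cmp\<close> brings composites into right-nested form.\<close>

lemmas arrow_simps = Dom_Obj Cod_Obj Cmp_Arr Dom_Cmp Cod_Cmp Idn_Arr Dom_Idn Cod_Idn
  Cmp_Idn_Dom Cmp_Idn_Cod Cmp_Cmp

lemma orthogonal_lift:
  assumes "orthogonal C e m" "in_hom C u (Dom C e) (Dom C m)" "in_hom C v (Cod C e) (Cod C m)"
    "m \<cdot> u = v \<cdot> e"
  obtains d where "in_hom C d (Cod C e) (Dom C m)" "d \<cdot> e = u" "m \<cdot> d = v"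
  using assms unfolding orthogonal_def by blast

lemma orthogonal_unique:
  assumes "orthogonal C e m" "e \<in> Arr C" "m \<in> Arr C"
    "in_hom C d (Cod C e) (Dom C m)" "in_hom C d' (Cod C e) (Dom C m)"
    "d \<cdot> e = d' \<cdot> e" "m \<cdot> d = m \<cdot> d'"
  shows "d = d'"
proof -
  have "in_hom C (d' \<cdot> e) (Dom C e) (Dom C m)" "in_hom C (m \<cdot> d') (Cod C e) (Cod C m)"
    "m \<cdot> (d' \<cdot> e) = (m \<cdot> d') \<cdot> e"
    using assms by (auto simp: in_hom_def arrow_simps)
  then show ?thesis
    using assms unfolding orthogonal_def by blast
qed

text \<open>Existence and uniqueness of the filler are separated. Uniqueness can be stated without a
  square, because a filler \<open>d\<close> determines its square by \<open>u = d \<cdot> e\<close>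
  and \<open>v = m \<cdot> d\<close>.\<close>

lemma orthogonalI:
  assumes "e \<in> Arr C" "m \<in> Arr C"
    and "\<And>u v. \<lbrakk>in_hom C u (Dom C e) (Dom C m); in_hom C v (Cod C e) (Cod C m); m \<cdot> u = v \<cdot> e\<rbrakk>
      \<Longrightarrow> \<exists>d. in_hom C d (Cod C e) (Dom C m) \<and> d \<cdot> e = u \<and> m \<cdot> d = v"
    and "\<And>d d'. \<lbrakk>in_hom C d (Cod C e) (Dom C m); in_hom C d' (Cod C e) (Dom C m);
      d \<cdot> e = d' \<cdot> e; m \<cdot> d = m \<cdot> d'\<rbrakk> \<Longrightarrow> d = d'"
  shows "orthogonal C e m"
  unfolding orthogonal_def
proof (intro allI impI, elim conjE)
  fix u v
  assume "in_hom C u (Dom C e) (Dom C m)" "in_hom C v (Cod C e) (Cod C m)" "m \<cdot> u = v \<cdot> e"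
  from assms(3)[OF this] assms(4)
  show "\<exists>!d. in_hom C d (Cod C e) (Dom C m) \<and> d \<cdot> e = u \<and> m \<cdot> d = v"
    by metis
qed

text \<open>The square is filled in two stages: a filler \<open>d1\<close> against \<open>n\<close>
  becomes the lower side of a square against \<open>m\<close>. Uniqueness descends through the same
  two stages.\<close>

lemma orthogonal_Cmp_right:
  assumes "orthogonal C e m" "orthogonal C e n" "e \<in> Arr C" "m \<in> Arr C" "n \<in> Arr C"
    "Cod C m = Dom C n"
  shows "orthogonal C e (n \<cdot> m)"
proof (rule orthogonalI)
  fix u v
  assume u: "in_hom C u (Dom C e) (Dom C (n \<cdot> m))" and v: "in_hom C v (Cod C e) (Cod C (n \<cdot> m))"
    and sq: "n \<cdot> m \<cdot> u = v \<cdot> e"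
  have "in_hom C (m \<cdot> u) (Dom C e) (Dom C n)" "in_hom C v (Cod C e) (Cod C n)"
    "n \<cdot> (m \<cdot> u) = v \<cdot> e"
    using u v sq assms(3-) by (auto simp: in_hom_def arrow_simps)
  with assms(2) obtain d1 where d1: "in_hom C d1 (Cod C e) (Dom C n)" "d1 \<cdot> e = m \<cdot> u" "n \<cdot> d1 = v"
    using orthogonal_lift by metis
  then have "in_hom C u (Dom C e) (Dom C m)" "in_hom C d1 (Cod C e) (Cod C m)" "m \<cdot> u = d1 \<cdot> e"
    using u assms(3-) by (auto simp: in_hom_def arrow_simps)
  with assms(1) obtain d where d: "in_hom C d (Cod C e) (Dom C m)" "d \<cdot> e = u" "m \<cdot> d = d1"
    using orthogonal_lift by metis
  then show "\<exists>d. in_hom C d (Cod C e) (Dom C (n \<cdot> m)) \<and> d \<cdot> e = u \<and> n \<cdot> m \<cdot> d = v"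
    using d1 assms(3-) by (intro exI[of _ d]) (auto simp: in_hom_def arrow_simps)
next
  fix d d'
  assume d: "in_hom C d (Cod C e) (Dom C (n \<cdot> m))" "in_hom C d' (Cod C e) (Dom C (n \<cdot> m))"
    and eq: "d \<cdot> e = d' \<cdot> e" "n \<cdot> m \<cdot> d = n \<cdot> m \<cdot> d'"
  have "m \<cdot> d = m \<cdot> d'"
  proof (rule orthogonal_unique[OF assms(2)])
    show "m \<cdot> d \<cdot> e = m \<cdot> d' \<cdot> e" "n \<cdot> (m \<cdot> d) = n \<cdot> (m \<cdot> d')"
      using d eq assms(3-) by (auto simp: in_hom_def arrow_simps)
  qed (use d assms(3-) in \<open>auto simp: in_hom_def arrow_simps\<close>)
  then show "d = d'"
    by (rule orthogonal_unique[OF assms(1), rotated -1])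
      (use d eq(1) assms in \<open>auto simp: arrow_simps\<close>)
qed (use assms in \<open>auto simp: arrow_simps\<close>)

text \<open>Dual staging: the filler \<open>d1\<close> along \<open>e\<close> becomes the upper side
  of a square along \<open>f\<close>.\<close>

lemma orthogonal_Cmp_left:
  assumes "orthogonal C e m" "orthogonal C f m" "e \<in> Arr C" "f \<in> Arr C" "m \<in> Arr C"
    "Cod C e = Dom C f"
  shows "orthogonal C (f \<cdot> e) m"
proof (rule orthogonalI)
  fix u v
  assume u: "in_hom C u (Dom C (f \<cdot> e)) (Dom C m)" and v: "in_hom C v (Cod C (f \<cdot> e)) (Cod C m)"
    and sq: "m \<cdot> u = v \<cdot> (f \<cdot> e)"
  have "in_hom C u (Dom C e) (Dom C m)" "in_hom C (v \<cdot> f) (Cod C e) (Cod C m)"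
    "m \<cdot> u = v \<cdot> f \<cdot> e"
    using u v sq assms(3-) by (auto simp: in_hom_def arrow_simps)
  with assms(1) obtain d1 where d1: "in_hom C d1 (Cod C e) (Dom C m)" "d1 \<cdot> e = u" "m \<cdot> d1 = v \<cdot> f"
    using orthogonal_lift by metis
  then have "in_hom C d1 (Dom C f) (Dom C m)" "in_hom C v (Cod C f) (Cod C m)" "m \<cdot> d1 = v \<cdot> f"
    using v assms(3-) by (auto simp: in_hom_def arrow_simps)
  with assms(2) obtain d where d: "in_hom C d (Cod C f) (Dom C m)" "d \<cdot> f = d1" "m \<cdot> d = v"
    using orthogonal_lift by metis
  moreover have "d \<cdot> (f \<cdot> e) = d \<cdot> f \<cdot> e"
    using d assms(3-) by (auto simp: in_hom_def arrow_simps)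
  ultimately show "\<exists>d. in_hom C d (Cod C (f \<cdot> e)) (Dom C m) \<and> d \<cdot> (f \<cdot> e) = u \<and> m \<cdot> d = v"
    using d1 assms(3-) by (intro exI[of _ d]) (auto simp: in_hom_def arrow_simps)
next
  fix d d'
  assume d: "in_hom C d (Cod C (f \<cdot> e)) (Dom C m)" "in_hom C d' (Cod C (f \<cdot> e)) (Dom C m)"
    and eq: "d \<cdot> (f \<cdot> e) = d' \<cdot> (f \<cdot> e)" "m \<cdot> d = m \<cdot> d'"
  have "m \<cdot> d \<cdot> f = m \<cdot> d' \<cdot> f"
    using eq by simp
  then have "m \<cdot> (d \<cdot> f) = m \<cdot> (d' \<cdot> f)"
    using d assms(3-) by (simp add: in_hom_def arrow_simps)
  then have "d \<cdot> f = d' \<cdot> f"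
    by (rule orthogonal_unique[OF assms(1), rotated -1])
      (use d eq assms(3-) in \<open>auto simp: in_hom_def arrow_simps\<close>)
  then show "d = d'"
    by (rule orthogonal_unique[OF assms(2) _ _ _ _ _ eq(2), rotated -1])
      (use d assms in \<open>auto simp: arrow_simps\<close>)
qed (use assms in \<open>auto simp: arrow_simps\<close>)

section \<open>Isomorphisms and orthogonality\<close>

lemma inverse_arrowsD:
  assumes "inverse_arrows C i j"
  shows "i \<in> Arr C" "j \<in> Arr C" "Dom C j = Cod C i" "Cod C j = Dom C i"
    "j \<cdot> i = Idn C (Dom C i)" "i \<cdot> j = Idn C (Cod C i)"
  using assms by (auto simp: inverse_arrows_def in_hom_def)

lemma inverse_cancel:
  assumes "inverse_arrows C i j"
  shows "\<lbrakk>f \<in> Arr C; Cod C f = Dom C i\<rbrakk> \<Longrightarrow> j \<cdot> (i \<cdot> f) = f"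
    and "\<lbrakk>f \<in> Arr C; Cod C f = Cod C i\<rbrakk> \<Longrightarrow> i \<cdot> (j \<cdot> f) = f"
    and "\<lbrakk>f \<in> Arr C; Dom C f = Cod C i\<rbrakk> \<Longrightarrow> (f \<cdot> i) \<cdot> j = f"
    and "\<lbrakk>f \<in> Arr C; Dom C f = Dom C i\<rbrakk> \<Longrightarrow> (f \<cdot> j) \<cdot> i = f"
proof -
  note i = inverse_arrowsD[OF assms]
  show "j \<cdot> (i \<cdot> f) = f" if "f \<in> Arr C" "Cod C f = Dom C i"
    using i that Cmp_Cmp[of f i j] by (simp add: Cmp_Idn_Cod)
  show "i \<cdot> (j \<cdot> f) = f" if "f \<in> Arr C" "Cod C f = Cod C i"
    using i that Cmp_Cmp[of f j i] by (simp add: Cmp_Idn_Cod)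
  show "(f \<cdot> i) \<cdot> j = f" if "f \<in> Arr C" "Dom C f = Cod C i"
    using i that by (simp add: arrow_simps)
  show "(f \<cdot> j) \<cdot> i = f" if "f \<in> Arr C" "Dom C f = Dom C i"
    using i that by (simp add: arrow_simps)
qed

lemma inverse_arrows_sym: "inverse_arrows C i j \<Longrightarrow> inverse_arrows C j i"
  by (auto simp: inverse_arrows_def in_hom_def)

text \<open>Since \<open>i\<close> is invertible, \<open>i \<cdot> d = v\<close> forces the filler
  \<open>j \<cdot> v\<close>; dually \<open>u \<cdot> j\<close> fills a square out of an
  isomorphism.\<close>

lemma orthogonal_iso_right:
  assumes "inverse_arrows C i j" "e \<in> Arr C"
  shows "orthogonal C e i"
proof (rule orthogonalI)
  note i = inverse_arrowsD[OF assms(1)]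
  fix u v
  assume u: "in_hom C u (Dom C e) (Dom C i)" and v: "in_hom C v (Cod C e) (Cod C i)"
    and sq: "i \<cdot> u = v \<cdot> e"
  have "j \<cdot> v \<cdot> e = j \<cdot> (i \<cdot> u)"
    using u v i assms(2) sq by (auto simp: in_hom_def arrow_simps)
  with u v show "\<exists>d. in_hom C d (Cod C e) (Dom C i) \<and> d \<cdot> e = u \<and> i \<cdot> d = v"
    using i inverse_cancel[OF assms(1)] by (intro exI[of _ "j \<cdot> v"]) (auto simp: in_hom_def arrow_simps)
next
  fix d d'
  assume "in_hom C d (Cod C e) (Dom C i)" "in_hom C d' (Cod C e) (Dom C i)" "i \<cdot> d = i \<cdot> d'"
  then show "d = d'"
    using inverse_cancel(1)[OF assms(1)] unfolding in_hom_def by metis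
qed (use inverse_arrowsD[OF assms(1)] assms(2) in auto)

lemma orthogonal_iso_left:
  assumes "inverse_arrows C i j" "m \<in> Arr C"
  shows "orthogonal C i m"
proof (rule orthogonalI)
  note i = inverse_arrowsD[OF assms(1)]
  fix u v
  assume u: "in_hom C u (Dom C i) (Dom C m)" and v: "in_hom C v (Cod C i) (Cod C m)"
    and sq: "m \<cdot> u = v \<cdot> i"
  have "m \<cdot> (u \<cdot> j) = v \<cdot> i \<cdot> j"
    using u v i assms(2) sq[symmetric] by (auto simp: in_hom_def Cmp_Cmp)
  with u v show "\<exists>d. in_hom C d (Cod C i) (Dom C m) \<and> d \<cdot> i = u \<and> m \<cdot> d = v"
    using i inverse_cancel[OF assms(1)]
    by (intro exI[of _ "u \<cdot> j"]) (auto simp: in_hom_def Cmp_Arr Dom_Cmp Cod_Cmp)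
next
  fix d d'
  assume "in_hom C d (Cod C i) (Dom C m)" "in_hom C d' (Cod C i) (Dom C m)" "d \<cdot> i = d' \<cdot> i"
  then show "d = d'"
    using inverse_cancel(3)[OF assms(1)] unfolding in_hom_def by metis
qed (use inverse_arrowsD[OF assms(1)] assms(2) in auto)

end

section \<open>Closure properties of the two classes of a factorisation system\<close>

locale factorisation_system = category C for C :: "('o, 'a, 'z) cat_scheme" (structure) +
  fixes E M :: "'a set"
  assumes ofs: "orthogonal_factorisation_system C E M"
begin

lemma E_iff: "e \<in> E \<longleftrightarrow> e \<in> Arr C \<and> (\<forall>m\<in>M. orthogonal C e m)"
  using ofs unfolding orthogonal_factorisation_system_def by blast

lemma M_iff: "m \<in> M \<longleftrightarrow> m \<in> Arr C \<and> (\<forall>e\<in>E. orthogonal C e m)"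
  using ofs unfolding orthogonal_factorisation_system_def by blast

lemma factorisation_exists: "f \<in> Arr C \<Longrightarrow> \<exists>e m. is_factorisation C E M f e m"
  using ofs unfolding orthogonal_factorisation_system_def by blast

lemma E_Arr: "e \<in> E \<Longrightarrow> e \<in> Arr C"
  by (simp add: E_iff)

lemma M_Arr: "m \<in> M \<Longrightarrow> m \<in> Arr C"
  by (simp add: M_iff)

lemma E_M_orthogonal: "\<lbrakk>e \<in> E; m \<in> M\<rbrakk> \<Longrightarrow> orthogonal C e m"
  by (simp add: E_iff)

text \<open>Each class consists of all arrows orthogonal to the other, so closure of
  \<open>E\<close> and \<open>M\<close> under isomorphisms and composition is inherited from the
  orthogonality relation.\<close>

lemma E_iso: "inverse_arrows C i j \<Longrightarrow> i \<in> E"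
  unfolding E_iff using orthogonal_iso_left M_Arr inverse_arrowsD(1) by blast

lemma M_iso: "inverse_arrows C i j \<Longrightarrow> i \<in> M"
  unfolding M_iff using orthogonal_iso_right E_Arr inverse_arrowsD(1) by blast

lemma E_Cmp: "\<lbrakk>e \<in> E; f \<in> E; Cod C e = Dom C f\<rbrakk> \<Longrightarrow> f \<cdot> e \<in> E"
  unfolding E_iff using orthogonal_Cmp_left Cmp_Arr M_Arr by metis

lemma M_Cmp: "\<lbrakk>m \<in> M; n \<in> M; Cod C m = Dom C n\<rbrakk> \<Longrightarrow> n \<cdot> m \<in> M"
  unfolding M_iff using orthogonal_Cmp_right Cmp_Arr E_Arr by metis

end


section \<open>Factorisation systems along an equivalence\<close>

definition faithful ::
  "('o, 'a, 'z) cat_scheme \<Rightarrow> ('p, 'b, 'y) cat_scheme \<Rightarrow> ('o, 'a, 'p, 'b) ftor \<Rightarrow> bool" where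
  "faithful C D F \<longleftrightarrow> is_functor C D F \<and>
     (\<forall>f g X Y. in_hom C f X Y \<and> in_hom C g X Y \<and> FArr F f = FArr F g \<longrightarrow> f = g)"

lemma functor_Arr:
  assumes "is_functor C D F" "f \<in> Arr C"
  shows "FArr F f \<in> Arr D" "Dom D (FArr F f) = FObj F (Dom C f)" "Cod D (FArr F f) = FObj F (Cod C f)"
  using assms unfolding is_functor_def in_hom_def by blast+

lemma functor_Obj: "\<lbrakk>is_functor C D F; A \<in> Obj C\<rbrakk> \<Longrightarrow> FObj F A \<in> Obj D"
  unfolding is_functor_def by blast

lemma functor_Idn: "\<lbrakk>is_functor C D F; A \<in> Obj C\<rbrakk> \<Longrightarrow> FArr F (Idn C A) = Idn D (FObj F A)"
  unfolding is_functor_def by blast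

lemma functor_Cmp:
  assumes "is_functor C D F" "f \<in> Arr C" "g \<in> Arr C" "Cod C f = Dom C g"
  shows "FArr F (g \<cdot>\<^bsub>C\<^esub> f) = FArr F g \<cdot>\<^bsub>D\<^esub> FArr F f"
  using assms unfolding is_functor_def in_hom_def by blast

lemma faithful_reflects_mono:
  assumes "faithful C D F" "category C" "m \<in> Arr C" "is_mono D (FArr F m)"
  shows "is_mono C m"
  unfolding is_mono_def
proof (intro conjI allI impI, fact, elim conjE)
  interpret category C by fact
  fix X f g
  assume fg: "in_hom C f X (Dom C m)" "in_hom C g X (Dom C m)" "m \<cdot>\<^bsub>C\<^esub> f = m \<cdot>\<^bsub>C\<^esub> g"
  have F: "is_functor C D F"
    using assms(1) by (simp add: faithful_def)
  have "FArr F m \<cdot>\<^bsub>D\<^esub> FArr F f = FArr F m \<cdot>\<^bsub>D\<^esub> FArr F g"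
    using fg assms(3) functor_Cmp[OF F] unfolding in_hom_def by metis
  moreover have "in_hom D (FArr F f) (FObj F X) (Dom D (FArr F m))"
    "in_hom D (FArr F g) (FObj F X) (Dom D (FArr F m))"
    using fg assms(3) by (auto simp: in_hom_def functor_Arr[OF F])
  ultimately have "FArr F f = FArr F g"
    using assms(4) unfolding is_mono_def by blast
  with fg show "f = g"
    using assms(1) unfolding faithful_def by blast
qed

lemma faithful_reflects_epi:
  assumes "faithful C D F" "category C" "e \<in> Arr C" "is_epi D (FArr F e)"
  shows "is_epi C e"
  unfolding is_epi_def
proof (intro conjI allI impI, fact, elim conjE)
  interpret category C by fact
  fix X f g
  assume fg: "in_hom C f (Cod C e) X" "in_hom C g (Cod C e) X" "f \<cdot>\<^bsub>C\<^esub> e = g \<cdot>\<^bsub>C\<^esub> e"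
  have F: "is_functor C D F"
    using assms(1) by (simp add: faithful_def)
  have "FArr F f \<cdot>\<^bsub>D\<^esub> FArr F e = FArr F g \<cdot>\<^bsub>D\<^esub> FArr F e"
    using fg assms(3) functor_Cmp[OF F] unfolding in_hom_def by metis
  moreover have "in_hom D (FArr F f) (Cod D (FArr F e)) (FObj F X)"
    "in_hom D (FArr F g) (Cod D (FArr F e)) (FObj F X)"
    using fg assms(3) by (auto simp: in_hom_def functor_Arr[OF F])
  ultimately have "FArr F f = FArr F g"
    using assms(4) unfolding is_epi_def by blast
  with fg show "f = g"
    using assms(1) unfolding faithful_def by blast
qed

section \<open>Equivalences of categories\<close>

locale equivalent_categories = C: category C + D: category D
  for C :: "('o, 'a, 'z) cat_scheme" and D :: "('p, 'b, 'y) cat_scheme" +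
  fixes F :: "('o, 'a, 'p, 'b) ftor" and G :: "('p, 'b, 'o, 'a) ftor"
    and \<eta> \<eta>' :: "'o \<Rightarrow> 'a" and \<epsilon> \<epsilon>' :: "'p \<Rightarrow> 'b"
  assumes F: "is_functor C D F" and G: "is_functor D C G"
    and \<eta>: "natural_transformation C C id_ftor (comp_ftor G F) \<eta>"
    and \<epsilon>: "natural_transformation D D (comp_ftor F G) id_ftor \<epsilon>"
    and \<eta>': "natural_transformation C C (comp_ftor G F) id_ftor \<eta>'"
    and \<epsilon>': "natural_transformation D D id_ftor (comp_ftor F G) \<epsilon>'"
    and \<eta>_inverse: "A \<in> Obj C \<Longrightarrow> inverse_arrows C (\<eta> A) (\<eta>' A)"
    and \<epsilon>_inverse: "B \<in> Obj D \<Longrightarrow> inverse_arrows D (\<epsilon> B) (\<epsilon>' B)"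
begin

text \<open>The inverse transformations are parameters with their own naturality, so exchanging the
  two categories only permutes the data. Faithfulness of \<open>G\<close>, on which fullness of
  \<open>F\<close> rests, is then an instance of faithfulness of \<open>F\<close>.\<close>

lemma swap: "equivalent_categories D C G F \<epsilon>' \<epsilon> \<eta>' \<eta>"
  using F G \<eta> \<epsilon> \<eta>' \<epsilon>' \<eta>_inverse \<epsilon>_inverse C.inverse_arrows_sym D.inverse_arrows_sym
  by unfold_locales auto

lemma \<eta>_hom:
  assumes "A \<in> Obj C"
  shows "\<eta> A \<in> Arr C" "Dom C (\<eta> A) = A" "Cod C (\<eta> A) = FObj G (FObj F A)"
    "\<eta>' A \<in> Arr C" "Dom C (\<eta>' A) = FObj G (FObj F A)" "Cod C (\<eta>' A) = A"
  using assms \<eta> \<eta>' by (auto simp: natural_transformation_def id_ftor_def comp_ftor_def in_hom_def)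

lemma \<eta>_natural:
  "f \<in> Arr C \<Longrightarrow> FArr G (FArr F f) \<cdot>\<^bsub>C\<^esub> \<eta> (Dom C f) = \<eta> (Cod C f) \<cdot>\<^bsub>C\<^esub> f"
  using \<eta> by (simp add: natural_transformation_def id_ftor_def comp_ftor_def in_hom_def)

text \<open>By naturality \<open>\<eta> Y \<cdot> f\<close> depends on \<open>f\<close> only through
  its image under \<open>F\<close>, and \<open>\<eta> Y\<close> can be cancelled.\<close>

lemma faithful_F: "faithful C D F"
  unfolding faithful_def
proof (intro conjI F allI impI, elim conjE)
  fix f g X Y
  assume fg: "in_hom C f X Y" "in_hom C g X Y" "FArr F f = FArr F g"
  then have Y: "Y \<in> Obj C"
    using C.Cod_Obj by (auto simp: in_hom_def)
  have "\<eta> Y \<cdot>\<^bsub>C\<^esub> f = \<eta> Y \<cdot>\<^bsub>C\<^esub> g"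
    using fg \<eta>_natural[of f] \<eta>_natural[of g] by (simp add: in_hom_def)
  then show "f = g"
    using C.inverse_cancel(1)[OF \<eta>_inverse[OF Y]] fg Y \<eta>_hom unfolding in_hom_def by metis
qed

end

context equivalent_categories
begin

interpretation swapped: equivalent_categories D C G F \<epsilon>' \<epsilon> \<eta>' \<eta>
  by (rule swap)

lemmas faithful_G = swapped.faithful_F
lemmas \<epsilon>_hom = swapped.\<eta>_hom

text \<open>The preimage of \<open>h\<close> is \<open>G h\<close> conjugated by the unit.
  Naturality shows that it has the same image under \<open>G F\<close> as \<open>h\<close> has under
  \<open>G\<close>, and \<open>G\<close> is faithful.\<close>

lemma full_F:
  assumes A: "A \<in> Obj C" and B: "B \<in> Obj C" and h: "in_hom D h (FObj F A) (FObj F B)"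
  obtains f where "in_hom C f A B" "FArr F f = h"
proof
  note h' = h[unfolded in_hom_def]
  note Gh = functor_Arr[OF G, of h]
  let ?f = "\<eta>' B \<cdot>\<^bsub>C\<^esub> (FArr G h \<cdot>\<^bsub>C\<^esub> \<eta> A)"
  show f: "in_hom C ?f A B"
    using h' A B by (simp add: in_hom_def C.arrow_simps \<eta>_hom Gh)
  have "FArr G (FArr F ?f) \<cdot>\<^bsub>C\<^esub> \<eta> A = \<eta> B \<cdot>\<^bsub>C\<^esub> ?f"
    using f \<eta>_natural[of ?f] by (simp add: in_hom_def)
  also have "\<dots> = FArr G h \<cdot>\<^bsub>C\<^esub> \<eta> A"
    using h' A B by (intro C.inverse_cancel[OF \<eta>_inverse]) (simp_all add: \<eta>_hom Gh C.arrow_simps)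
  finally have "(FArr G (FArr F ?f) \<cdot>\<^bsub>C\<^esub> \<eta> A) \<cdot>\<^bsub>C\<^esub> \<eta>' A = (FArr G h \<cdot>\<^bsub>C\<^esub> \<eta> A) \<cdot>\<^bsub>C\<^esub> \<eta>' A"
    by simp
  moreover have Ff: "in_hom D (FArr F ?f) (FObj F A) (FObj F B)"
    using f functor_Arr[OF F, of ?f] by (simp add: in_hom_def)
  moreover have "FArr G (FArr F ?f) \<in> Arr C" "Dom C (FArr G (FArr F ?f)) = FObj G (FObj F A)"
    using Ff functor_Arr[OF G, of "FArr F ?f"] by (simp_all add: in_hom_def)
  ultimately have "FArr G (FArr F ?f) = FArr G h"
    using h' A C.inverse_cancel(3)[OF \<eta>_inverse[OF A]] by (simp add: \<eta>_hom Gh)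
  then show "FArr F ?f = h"
    using faithful_G Ff h unfolding faithful_def by blast
qed

lemma F_cancel: "\<lbrakk>in_hom C f X Y; in_hom C g X Y; FArr F f = FArr F g\<rbrakk> \<Longrightarrow> f = g"
  using faithful_F unfolding faithful_def by blast

text \<open>Full faithfulness matches the squares from \<open>e\<close> to \<open>m\<close>, and
  their fillers, with those between the images: fullness supplies preimages of sides and fillers,
  and \<open>F_cancel\<close> brings the equations back.\<close>

lemma orthogonal_iff:
  assumes e: "e \<in> Arr C" and m: "m \<in> Arr C"
  shows "orthogonal C e m \<longleftrightarrow> orthogonal D (FArr F e) (FArr F m)"
proof
  note simps = functor_Arr[OF F] functor_Cmp[OF F] C.arrow_simps D.arrow_simps
  have lift: "in_hom D (FArr F f) (FObj F X) (FObj F Y)" if "in_hom C f X Y" for f X Y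
    using that by (simp add: in_hom_def simps)
  assume orth: "orthogonal C e m"
  show "orthogonal D (FArr F e) (FArr F m)"
  proof (rule D.orthogonalI)
    fix u v
    assume u: "in_hom D u (Dom D (FArr F e)) (Dom D (FArr F m))"
      and v: "in_hom D v (Cod D (FArr F e)) (Cod D (FArr F m))"
      and sq: "FArr F m \<cdot>\<^bsub>D\<^esub> u = v \<cdot>\<^bsub>D\<^esub> FArr F e"
    obtain u' where u': "in_hom C u' (Dom C e) (Dom C m)" "FArr F u' = u"
      by (rule full_F[of "Dom C e" "Dom C m" u]) (use u e m in \<open>simp_all add: simps\<close>)
    obtain v' where v': "in_hom C v' (Cod C e) (Cod C m)" "FArr F v' = v"
      by (rule full_F[of "Cod C e" "Cod C m" v]) (use v e m in \<open>simp_all add: simps\<close>)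
    have "m \<cdot>\<^bsub>C\<^esub> u' = v' \<cdot>\<^bsub>C\<^esub> e"
      by (rule F_cancel[of _ "Dom C e" "Cod C m"])
        (use u' v' e m sq in \<open>auto simp: simps in_hom_def\<close>)
    then obtain d where d: "in_hom C d (Cod C e) (Dom C m)" "d \<cdot>\<^bsub>C\<^esub> e = u'" "m \<cdot>\<^bsub>C\<^esub> d = v'"
      using C.orthogonal_lift orth u' v' by metis
    have "FArr F d \<cdot>\<^bsub>D\<^esub> FArr F e = u" "FArr F m \<cdot>\<^bsub>D\<^esub> FArr F d = v"
      using d e m u'(2) v'(2) functor_Cmp[OF F] by (auto simp: in_hom_def)
    with lift[OF d(1)]
    show "\<exists>d. in_hom D d (Cod D (FArr F e)) (Dom D (FArr F m)) \<and> d \<cdot>\<^bsub>D\<^esub> FArr F e = u \<and>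
        FArr F m \<cdot>\<^bsub>D\<^esub> d = v"
      using e m by (auto simp: simps)
  next
    fix d d'
    assume d: "in_hom D d (Cod D (FArr F e)) (Dom D (FArr F m))"
      and d': "in_hom D d' (Cod D (FArr F e)) (Dom D (FArr F m))"
      and eq: "d \<cdot>\<^bsub>D\<^esub> FArr F e = d' \<cdot>\<^bsub>D\<^esub> FArr F e" "FArr F m \<cdot>\<^bsub>D\<^esub> d = FArr F m \<cdot>\<^bsub>D\<^esub> d'"
    obtain c where c: "in_hom C c (Cod C e) (Dom C m)" "FArr F c = d"
      by (rule full_F[of "Cod C e" "Dom C m" d]) (use d e m in \<open>simp_all add: simps\<close>)
    obtain c' where c': "in_hom C c' (Cod C e) (Dom C m)" "FArr F c' = d'"
      by (rule full_F[of "Cod C e" "Dom C m" d']) (use d' e m in \<open>simp_all add: simps\<close>)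
    have "c \<cdot>\<^bsub>C\<^esub> e = c' \<cdot>\<^bsub>C\<^esub> e"
      by (rule F_cancel[of _ "Dom C e" "Dom C m"])
        (use c c' e m eq in \<open>auto simp: simps in_hom_def\<close>)
    moreover have "m \<cdot>\<^bsub>C\<^esub> c = m \<cdot>\<^bsub>C\<^esub> c'"
      by (rule F_cancel[of _ "Cod C e" "Cod C m"])
        (use c c' e m eq in \<open>auto simp: simps in_hom_def\<close>)
    ultimately have "c = c'"
      using C.orthogonal_unique[OF orth e m c(1) c'(1)] by blast
    with c c' show "d = d'"
      by simp
  qed (use e m in \<open>simp_all add: simps\<close>)
next
  note simps = functor_Arr[OF F] functor_Cmp[OF F] C.arrow_simps D.arrow_simps
  assume orth: "orthogonal D (FArr F e) (FArr F m)"
  show "orthogonal C e m"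
  proof (rule C.orthogonalI[OF e m])
    fix u v
    assume u: "in_hom C u (Dom C e) (Dom C m)" and v: "in_hom C v (Cod C e) (Cod C m)"
      and sq: "m \<cdot>\<^bsub>C\<^esub> u = v \<cdot>\<^bsub>C\<^esub> e"
    have sq': "FArr F m \<cdot>\<^bsub>D\<^esub> FArr F u = FArr F v \<cdot>\<^bsub>D\<^esub> FArr F e"
      using u v e m sq functor_Cmp[OF F] unfolding in_hom_def by metis
    obtain c where c: "in_hom D c (FObj F (Cod C e)) (FObj F (Dom C m))"
      "c \<cdot>\<^bsub>D\<^esub> FArr F e = FArr F u" "FArr F m \<cdot>\<^bsub>D\<^esub> c = FArr F v"
      by (rule D.orthogonal_lift[OF orth, of "FArr F u" "FArr F v"])
        (use u v e m sq' in \<open>auto simp: in_hom_def simps\<close>)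
    obtain d where d: "in_hom C d (Cod C e) (Dom C m)" "FArr F d = c"
      by (rule full_F[OF _ _ c(1)]) (use e m in \<open>simp_all add: simps\<close>)
    have "d \<cdot>\<^bsub>C\<^esub> e = u"
      by (rule F_cancel[of _ "Dom C e" "Dom C m"]) (use c d e m u in \<open>auto simp: simps in_hom_def\<close>)
    moreover have "m \<cdot>\<^bsub>C\<^esub> d = v"
      by (rule F_cancel[of _ "Cod C e" "Cod C m"]) (use c d e m v in \<open>auto simp: simps in_hom_def\<close>)
    ultimately show "\<exists>d. in_hom C d (Cod C e) (Dom C m) \<and> d \<cdot>\<^bsub>C\<^esub> e = u \<and> m \<cdot>\<^bsub>C\<^esub> d = v"
      using d by blast
  next
    fix d d'
    assume d: "in_hom C d (Cod C e) (Dom C m)" "in_hom C d' (Cod C e) (Dom C m)"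
      and eq: "d \<cdot>\<^bsub>C\<^esub> e = d' \<cdot>\<^bsub>C\<^esub> e" "m \<cdot>\<^bsub>C\<^esub> d = m \<cdot>\<^bsub>C\<^esub> d'"
    have "FArr F d \<cdot>\<^bsub>D\<^esub> FArr F e = FArr F d' \<cdot>\<^bsub>D\<^esub> FArr F e"
      "FArr F m \<cdot>\<^bsub>D\<^esub> FArr F d = FArr F m \<cdot>\<^bsub>D\<^esub> FArr F d'"
      using d e m eq functor_Cmp[OF F] unfolding in_hom_def by metis+
    then have "FArr F d = FArr F d'"
      by (rule D.orthogonal_unique[OF orth, rotated -2])
        (use d e m in \<open>auto simp: in_hom_def simps\<close>)
    with d show "d = d'"
      using F_cancel by blast
  qed
qed

section \<open>Arrows up to conjugation by the counit\<close>

lemma FG_conjugate: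
  assumes f: "f \<in> Arr D"
  shows "FArr F (FArr G f) = \<epsilon>' (Cod D f) \<cdot>\<^bsub>D\<^esub> f \<cdot>\<^bsub>D\<^esub> \<epsilon> (Dom D f)"
    and "f = \<epsilon> (Cod D f) \<cdot>\<^bsub>D\<^esub> FArr F (FArr G f) \<cdot>\<^bsub>D\<^esub> \<epsilon>' (Dom D f)"
proof -
  have FGf: "FArr F (FArr G f) \<in> Arr D" "Dom D (FArr F (FArr G f)) = FObj F (FObj G (Dom D f))"
    "Cod D (FArr F (FArr G f)) = FObj F (FObj G (Cod D f))"
    using f functor_Arr[OF G f] functor_Arr[OF F, of "FArr G f"] by simp_all
  have obj: "Dom D f \<in> Obj D" "Cod D f \<in> Obj D"
    using f by (simp_all add: D.arrow_simps)
  have nat: "FArr F (FArr G f) \<cdot>\<^bsub>D\<^esub> \<epsilon>' (Dom D f) = \<epsilon>' (Cod D f) \<cdot>\<^bsub>D\<^esub> f"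
    using swapped.\<eta>_natural[OF f] .
  show "FArr F (FArr G f) = \<epsilon>' (Cod D f) \<cdot>\<^bsub>D\<^esub> f \<cdot>\<^bsub>D\<^esub> \<epsilon> (Dom D f)"
    unfolding nat[symmetric]
    using FGf obj D.inverse_cancel(4)[OF \<epsilon>_inverse] by (simp add: \<epsilon>_hom)
  have "\<epsilon> (Cod D f) \<cdot>\<^bsub>D\<^esub> FArr F (FArr G f) \<cdot>\<^bsub>D\<^esub> \<epsilon>' (Dom D f) = \<epsilon> (Cod D f) \<cdot>\<^bsub>D\<^esub> (\<epsilon>' (Cod D f) \<cdot>\<^bsub>D\<^esub> f)"
    unfolding nat[symmetric] using FGf obj by (simp add: D.arrow_simps \<epsilon>_hom)
  also have "\<dots> = f"
    using f obj D.inverse_cancel(2)[OF \<epsilon>_inverse] by (simp add: \<epsilon>_hom)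
  finally show "f = \<epsilon> (Cod D f) \<cdot>\<^bsub>D\<^esub> FArr F (FArr G f) \<cdot>\<^bsub>D\<^esub> \<epsilon>' (Dom D f)"
    by simp
qed

text \<open>\<open>F (G f)\<close> and \<open>f\<close> arise from each other by composition with
  components of the counit and its inverse, and isomorphisms are orthogonal to everything on either
  side. This lets an arbitrary arrow of \<open>D\<close> be replaced by one in the image of
  \<open>F\<close>.\<close>

lemma orthogonal_FG_iff:
  assumes e: "e \<in> Arr D" and m: "m \<in> Arr D"
  shows "orthogonal D e (FArr F (FArr G m)) \<longleftrightarrow> orthogonal D e m"
    and "orthogonal D (FArr F (FArr G e)) m \<longleftrightarrow> orthogonal D e m"
proof -
  have FG: "FArr F (FArr G f) \<in> Arr D" "Dom D (FArr F (FArr G f)) = FObj F (FObj G (Dom D f))"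
    "Cod D (FArr F (FArr G f)) = FObj F (FObj G (Cod D f))" if "f \<in> Arr D" for f
    using that functor_Arr[OF G that] functor_Arr[OF F, of "FArr G f"] by simp_all
  note simps = FG \<epsilon>_hom D.arrow_simps
  have iso: "inverse_arrows D (\<epsilon> X) (\<epsilon>' X)" "inverse_arrows D (\<epsilon>' X) (\<epsilon> X)" if "X \<in> Obj D" for X
    using that \<epsilon>_inverse D.inverse_arrows_sym by blast+
  have orth: "orthogonal D f (\<epsilon> X)" "orthogonal D f (\<epsilon>' X)" "orthogonal D (\<epsilon> X) f" "orthogonal D (\<epsilon>' X) f"
    if "X \<in> Obj D" "f \<in> Arr D" for f X
    using that iso D.orthogonal_iso_left D.orthogonal_iso_right by blast+
  show "orthogonal D e (FArr F (FArr G m)) \<longleftrightarrow> orthogonal D e m"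
  proof
    assume "orthogonal D e (FArr F (FArr G m))"
    then have "orthogonal D e (\<epsilon> (Cod D m) \<cdot>\<^bsub>D\<^esub> FArr F (FArr G m) \<cdot>\<^bsub>D\<^esub> \<epsilon>' (Dom D m))"
      using e m by (intro D.orthogonal_Cmp_right orth) (auto simp: simps)
    then show "orthogonal D e m"
      using FG_conjugate(2)[OF m] by simp
  next
    assume "orthogonal D e m"
    then have "orthogonal D e (\<epsilon>' (Cod D m) \<cdot>\<^bsub>D\<^esub> m \<cdot>\<^bsub>D\<^esub> \<epsilon> (Dom D m))"
      using e m by (intro D.orthogonal_Cmp_right orth) (auto simp: simps)
    then show "orthogonal D e (FArr F (FArr G m))"
      using FG_conjugate(1)[OF m] by simp
  qed
  show "orthogonal D (FArr F (FArr G e)) m \<longleftrightarrow> orthogonal D e m"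
  proof
    assume "orthogonal D (FArr F (FArr G e)) m"
    then have "orthogonal D (\<epsilon> (Cod D e) \<cdot>\<^bsub>D\<^esub> FArr F (FArr G e) \<cdot>\<^bsub>D\<^esub> \<epsilon>' (Dom D e)) m"
      using e m by (intro D.orthogonal_Cmp_left orth) (auto simp: simps)
    then show "orthogonal D e m"
      using FG_conjugate(2)[OF e] by simp
  next
    assume "orthogonal D e m"
    then have "orthogonal D (\<epsilon>' (Cod D e) \<cdot>\<^bsub>D\<^esub> e \<cdot>\<^bsub>D\<^esub> \<epsilon> (Dom D e)) m"
      using e m by (intro D.orthogonal_Cmp_left orth) (auto simp: simps)
    then show "orthogonal D (FArr F (FArr G e)) m"
      using FG_conjugate(1)[OF e] by simp
  qed
qed

section \<open>Inverse image of a factorisation system along an equivalence\<close>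

definition preimage :: "'b set \<Rightarrow> 'a set" where
  "preimage S = {f \<in> Arr C. FArr F f \<in> S}"

context
  fixes E M
  assumes EM: "orthogonal_factorisation_system D E M"
begin

interpretation factorisation_system D E M
  by unfold_locales (rule EM)

text \<open>Every arrow of \<open>E\<close> or \<open>M\<close> has a representative in the inverse
  image: its conjugate \<open>F (G f)\<close> stays in the class because the class is defined by
  orthogonality.\<close>

lemma G_preimage:
  shows "m \<in> M \<Longrightarrow> FArr G m \<in> preimage M" "e \<in> E \<Longrightarrow> FArr G e \<in> preimage E"
proof -
  have GF: "FArr G f \<in> Arr C" "FArr F (FArr G f) \<in> Arr D" if "f \<in> Arr D" for f
    using functor_Arr[OF G that] functor_Arr[OF F, of "FArr G f"] by auto
  show "FArr G m \<in> preimage M" if "m \<in> M"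
    using that GF orthogonal_FG_iff(1) E_Arr unfolding preimage_def M_iff by blast
  show "FArr G e \<in> preimage E" if "e \<in> E"
    using that GF orthogonal_FG_iff(2) M_Arr unfolding preimage_def E_iff by blast
qed

text \<open>The middle object \<open>?P\<close> of a factorisation of \<open>F f\<close> need not be
  an object in the image of \<open>F\<close>. Inserting \<open>\<epsilon>' ?P\<close> and
  \<open>\<epsilon> ?P\<close> between the two factors moves it to \<open>F (G ?P)\<close> without
  leaving \<open>E\<close> and \<open>M\<close>, and then both factors lift by fullness.\<close>

lemma preimage_factorisation:
  assumes f: "f \<in> Arr C"
  shows "\<exists>e m. is_factorisation C (preimage E) (preimage M) f e m"
proof -
  obtain e m where em: "e \<in> E" "m \<in> M" "Cod D e = Dom D m" "m \<cdot>\<^bsub>D\<^esub> e = FArr F f"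
    using factorisation_exists functor_Arr(1)[OF F f] unfolding is_factorisation_def by blast
  let ?P = "Dom D m"
  have P: "?P \<in> Obj D" "FObj G ?P \<in> Obj C"
    using em M_Arr D.Dom_Obj functor_Obj[OF G] by auto
  have arr: "e \<in> Arr D" "m \<in> Arr D"
    using em E_Arr M_Arr by auto
  have iso: "inverse_arrows D (\<epsilon> ?P) (\<epsilon>' ?P)" "inverse_arrows D (\<epsilon>' ?P) (\<epsilon> ?P)"
    using \<epsilon>_inverse[OF P(1)] D.inverse_arrows_sym by blast+
  have dom: "Dom D e = FObj F (Dom C f)" "Cod D m = FObj F (Cod C f)"
    using em(3) arr functor_Arr[OF F f] D.Dom_Cmp[of e m] D.Cod_Cmp[of e m] unfolding em(4) by simp_all
  have fobj: "Dom C f \<in> Obj C" "Cod C f \<in> Obj C"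
    using f by (simp_all add: C.arrow_simps)
  have e': "\<epsilon>' ?P \<cdot>\<^bsub>D\<^esub> e \<in> E" and m': "m \<cdot>\<^bsub>D\<^esub> \<epsilon> ?P \<in> M"
    using E_Cmp[OF em(1) E_iso[OF iso(2)]] M_Cmp[OF M_iso[OF iso(1)] em(2)] em(3) P
    by (simp_all add: \<epsilon>_hom)
  obtain a where a: "in_hom C a (Dom C f) (FObj G ?P)" "FArr F a = \<epsilon>' ?P \<cdot>\<^bsub>D\<^esub> e"
    by (rule full_F[of "Dom C f" "FObj G ?P" "\<epsilon>' ?P \<cdot>\<^bsub>D\<^esub> e"])
      (use fobj P arr dom em(3) in \<open>simp_all add: in_hom_def \<epsilon>_hom D.arrow_simps\<close>)
  obtain b where b: "in_hom C b (FObj G ?P) (Cod C f)" "FArr F b = m \<cdot>\<^bsub>D\<^esub> \<epsilon> ?P"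
    by (rule full_F[of "FObj G ?P" "Cod C f" "m \<cdot>\<^bsub>D\<^esub> \<epsilon> ?P"])
      (use fobj P arr dom em(3) in \<open>simp_all add: in_hom_def \<epsilon>_hom D.arrow_simps\<close>)
  have "FArr F (b \<cdot>\<^bsub>C\<^esub> a) = m \<cdot>\<^bsub>D\<^esub> \<epsilon> ?P \<cdot>\<^bsub>D\<^esub> (\<epsilon>' ?P \<cdot>\<^bsub>D\<^esub> e)"
    using a b functor_Cmp[OF F, of a b] by (simp add: in_hom_def)
  also have "\<dots> = m \<cdot>\<^bsub>D\<^esub> (\<epsilon> ?P \<cdot>\<^bsub>D\<^esub> (\<epsilon>' ?P \<cdot>\<^bsub>D\<^esub> e))"
    using P arr em(3) by (simp add: \<epsilon>_hom D.arrow_simps)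
  also have "\<dots> = m \<cdot>\<^bsub>D\<^esub> e"
    using P arr em(3) D.inverse_cancel(2)[OF iso(1)] by (simp add: \<epsilon>_hom)
  finally have Fba: "FArr F (b \<cdot>\<^bsub>C\<^esub> a) = FArr F f"
    by (simp add: em(4))
  have "b \<cdot>\<^bsub>C\<^esub> a = f"
    by (rule F_cancel[OF _ _ Fba]) (use a b f in \<open>auto simp: in_hom_def C.arrow_simps\<close>)
  moreover have "a \<in> preimage E" "b \<in> preimage M"
    using a b e' m' by (auto simp: preimage_def in_hom_def)
  ultimately show ?thesis
    using a(1) b(1) unfolding is_factorisation_def in_hom_def by metis
qed

text \<open>The substance is maximality of the two classes. An arrow orthogonal to the inverse image
  of \<open>M\<close> is tested there against \<open>G m\<close> for each \<open>m \<in> M\<close>;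
  its image is then orthogonal to \<open>F (G m)\<close>, hence to \<open>m\<close>. The argument
  for the other class is dual.\<close>

lemma preimage_ofs: "orthogonal_factorisation_system C (preimage E) (preimage M)"
  unfolding orthogonal_factorisation_system_def
proof (intro conjI ballI preimage_factorisation)
  have orth: "orthogonal C e m" if "e \<in> preimage E" "m \<in> preimage M" for e m
    using that orthogonal_iff E_M_orthogonal unfolding preimage_def by blast
  have GA: "FArr G f \<in> Arr C" if "f \<in> Arr D" for f
    using functor_Arr(1)[OF G that] .
  have FA: "FArr F f \<in> Arr D" if "f \<in> Arr C" for f
    using functor_Arr(1)[OF F that] .
  show "preimage E = {e \<in> Arr C. \<forall>m\<in>preimage M. orthogonal C e m}"
  proof (intro equalityI subsetI)
    fix e assume e: "e \<in> {e \<in> Arr C. \<forall>m\<in>preimage M. orthogonal C e m}"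
    have "orthogonal D (FArr F e) m" if "m \<in> M" for m
    proof -
      have "orthogonal C e (FArr G m)"
        using e G_preimage(1)[OF that] by blast
      then have "orthogonal D (FArr F e) (FArr F (FArr G m))"
        using orthogonal_iff[of e "FArr G m"] e GA M_Arr that by auto
      then show ?thesis
        using orthogonal_FG_iff(1)[of "FArr F e" m] e FA M_Arr that by auto
    qed
    then show "e \<in> preimage E"
      using e FA by (auto simp: preimage_def E_iff)
  qed (use orth in \<open>auto simp: preimage_def\<close>)
  show "preimage M = {m \<in> Arr C. \<forall>e\<in>preimage E. orthogonal C e m}"
  proof (intro equalityI subsetI)
    fix m assume m: "m \<in> {m \<in> Arr C. \<forall>e\<in>preimage E. orthogonal C e m}"
    have "orthogonal D e (FArr F m)" if "e \<in> E" for e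
    proof -
      have "orthogonal C (FArr G e) m"
        using m G_preimage(2)[OF that] by blast
      then have "orthogonal D (FArr F (FArr G e)) (FArr F m)"
        using orthogonal_iff[of "FArr G e" m] m GA E_Arr that by auto
      then show ?thesis
        using orthogonal_FG_iff(2)[of e "FArr F m"] m FA E_Arr that by auto
    qed
    then show "m \<in> preimage M"
      using m FA by (auto simp: preimage_def M_iff)
  qed (use orth in \<open>auto simp: preimage_def\<close>)
qed

text \<open>Faithful functors reflect monomorphisms and epimorphisms. Reflection along
  \<open>G\<close> gives properness in \<open>D\<close>, since \<open>G\<close> sends each class
  into its inverse image; reflection along \<open>F\<close> gives properness in
  \<open>C\<close>.\<close>

lemma proper_preimage_iff:
  "proper_factorisation_system C (preimage E) (preimage M) \<longleftrightarrow> proper_factorisation_system D E M"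
proof
  assume proper: "proper_factorisation_system C (preimage E) (preimage M)"
  show "proper_factorisation_system D E M"
    unfolding proper_factorisation_system_def
  proof (intro conjI ballI EM)
    fix e assume "e \<in> E"
    then show "is_epi D e"
      using proper G_preimage(2) E_Arr faithful_reflects_epi[OF faithful_G D.category_axioms]
      unfolding proper_factorisation_system_def by blast
  next
    fix m assume "m \<in> M"
    then show "is_mono D m"
      using proper G_preimage(1) M_Arr faithful_reflects_mono[OF faithful_G D.category_axioms]
      unfolding proper_factorisation_system_def by blast
  qed
next
  assume proper: "proper_factorisation_system D E M"
  show "proper_factorisation_system C (preimage E) (preimage M)"
    unfolding proper_factorisation_system_def
  proof (intro conjI ballI preimage_ofs)
    fix e assume "e \<in> preimage E"
    then show "is_epi C e"
      using proper faithful_reflects_epi[OF faithful_F C.category_axioms]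
      unfolding proper_factorisation_system_def preimage_def by blast
  next
    fix m assume "m \<in> preimage M"
    then show "is_mono C m"
      using proper faithful_reflects_mono[OF faithful_F C.category_axioms]
      unfolding proper_factorisation_system_def preimage_def by blast
  qed
qed

end

end


section \<open>Local posetality along pseudo double functors\<close>

text \<open>The part of the structure of a double category that local posetality depends on.\<close>

locale unital_double_graph =
  fixes D :: "('o, 'v, 'h, 'c, 'z) dblcat_scheme" (structure)
  assumes VCat_category: "category (VCat D)"
    and HCat_category: "category (HCat D)"
    and Src_functor: "is_functor (HCat D) (VCat D) (Src D)"
    and Tgt_functor: "is_functor (HCat D) (VCat D) (Tgt D)"
    and Src_HId: "A \<in> Obj (VCat D) \<Longrightarrow> FObj (Src D) (FObj (HId D) A) = A"
    and Tgt_HId: "A \<in> Obj (VCat D) \<Longrightarrow> FObj (Tgt D) (FObj (HId D) A) = A"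

lemma (in double_category) unital_double_graph: "unital_double_graph D"
  using VCat_category HCat_category Src_functor Tgt_functor Src_HId Tgt_HId
  by (intro unital_double_graph.intro) auto

text \<open>Applied to the source and target functors, this makes the inverse of a globular
  isomorphism globular.\<close>

lemma functor_inverse_identity:
  assumes "category C" "category V" "is_functor C V S" "inverse_arrows C \<alpha> \<beta>"
    "FArr S \<alpha> = Idn V (FObj S (Dom C \<alpha>))"
  shows "FArr S \<beta> = Idn V (FObj S (Dom C \<alpha>))"
proof -
  interpret C: category C by fact
  interpret V: category V by fact
  note inv = C.inverse_arrowsD[OF assms(4)]
  have X: "Dom C \<alpha> \<in> Obj C" "FObj S (Dom C \<alpha>) \<in> Obj V"
    using inv C.Dom_Obj functor_Obj[OF assms(3)] by auto
  have S\<beta>: "FArr S \<beta> \<in> Arr V" "Dom V (FArr S \<beta>) = FObj S (Cod C \<alpha>)"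
    using functor_Arr[OF assms(3) inv(2)] inv by auto
  have "FObj S (Cod C \<alpha>) = FObj S (Dom C \<alpha>)"
    using functor_Arr(3)[OF assms(3) inv(1)] assms(5) X V.Cod_Idn by simp
  then have "FArr S \<beta> = FArr S \<beta> \<cdot>\<^bsub>V\<^esub> FArr S \<alpha>"
    using S\<beta> assms(5) V.Cmp_Idn_Dom by simp
  also have "\<dots> = FArr S (\<beta> \<cdot>\<^bsub>C\<^esub> \<alpha>)"
    using functor_Cmp[OF assms(3) inv(1,2)] inv by simp
  also have "\<dots> = Idn V (FObj S (Dom C \<alpha>))"
    using inv functor_Idn[OF assms(3) X(1)] by simp
  finally show ?thesis .
qed

section \<open>Cells between horizontal identities\<close>

context unital_double_graph
begin

interpretation V: category "VCat D" by (rule VCat_category)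
interpretation H: category "HCat D" by (rule HCat_category)

lemma globular_iso_inverse:
  assumes "globular_iso D \<alpha> p q"
  obtains \<beta> where "in_hom (HCat D) \<beta> q p"
    "FArr (Src D) \<beta> = Idn (VCat D) (FObj (Src D) p)"
    "FArr (Tgt D) \<beta> = Idn (VCat D) (FObj (Tgt D) p)"
proof -
  obtain \<beta> where \<beta>: "inverse_arrows (HCat D) \<alpha> \<beta>"
    using assms unfolding globular_iso_def is_iso_def by blast
  have p: "Dom (HCat D) \<alpha> = p" "Cod (HCat D) \<alpha> = q"
    using assms by (auto simp: globular_iso_def in_hom_def)
  show thesis
  proof (rule that)
    show "in_hom (HCat D) \<beta> q p"
      using \<beta> p by (simp add: inverse_arrows_def)
    show "FArr (Src D) \<beta> = Idn (VCat D) (FObj (Src D) p)"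
      using functor_inverse_identity[OF HCat_category VCat_category Src_functor \<beta>] assms p
      by (simp add: globular_iso_def)
    show "FArr (Tgt D) \<beta> = Idn (VCat D) (FObj (Tgt D) p)"
      using functor_inverse_identity[OF HCat_category VCat_category Tgt_functor \<beta>] assms p
      by (simp add: globular_iso_def)
  qed
qed

text \<open>Parallel arrows of a hom-category are cells with equal boundary, so thinness already
  follows from the local preorder and only antisymmetry remains. It is phrased through the sides of
  cells, which are the objects that the hom-category would compare.\<close>

lemma locally_posetal_iff:
  "locally_posetal D \<longleftrightarrow> locally_preordered D \<and>
     (\<forall>A\<in>Obj (VCat D). \<forall>B\<in>Obj (VCat D). \<forall>\<alpha> \<beta>.
        in_hom (HCat D) \<alpha> (FObj (HId D) A) (FObj (HId D) B) \<and>
        in_hom (HCat D) \<beta> (FObj (HId D) A) (FObj (HId D) B) \<and>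
        FArr (Src D) \<alpha> = FArr (Tgt D) \<beta> \<and> FArr (Tgt D) \<alpha> = FArr (Src D) \<beta> \<longrightarrow>
        FArr (Src D) \<alpha> = FArr (Tgt D) \<alpha>)"
proof -
  have hom: "in_hom (vertical_hom_category D A B) \<alpha> f g \<longleftrightarrow>
      in_hom (HCat D) \<alpha> (FObj (HId D) A) (FObj (HId D) B) \<and> FArr (Src D) \<alpha> = f \<and> FArr (Tgt D) \<alpha> = g"
    for A B \<alpha> f g
    by (simp add: vertical_hom_category_def in_hom_def)
  have thin: "\<forall>x y f g. in_hom (vertical_hom_category D A B) f x y \<and>
      in_hom (vertical_hom_category D A B) g x y \<longrightarrow> f = g" if "locally_preordered D" for A B
    using that unfolding hom locally_preordered_def by blast
  have antisym: "(\<forall>x y f g. in_hom (vertical_hom_category D A B) f x y \<and>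
        in_hom (vertical_hom_category D A B) g y x \<longrightarrow> x = y) \<longleftrightarrow>
      (\<forall>\<alpha> \<beta>. in_hom (HCat D) \<alpha> (FObj (HId D) A) (FObj (HId D) B) \<and>
        in_hom (HCat D) \<beta> (FObj (HId D) A) (FObj (HId D) B) \<and>
        FArr (Src D) \<alpha> = FArr (Tgt D) \<beta> \<and> FArr (Tgt D) \<alpha> = FArr (Src D) \<beta> \<longrightarrow>
        FArr (Src D) \<alpha> = FArr (Tgt D) \<alpha>)" for A B
    unfolding hom by (auto; metis)
  show ?thesis
    unfolding locally_posetal_def poset_category_def antisym using thin by blast
qed

lemma unit_cell_sides:
  assumes "A \<in> Obj (VCat D)" "B \<in> Obj (VCat D)"
    "in_hom (HCat D) \<alpha> (FObj (HId D) A) (FObj (HId D) B)"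
  shows "in_hom (VCat D) (FArr (Src D) \<alpha>) A B" "in_hom (VCat D) (FArr (Tgt D) \<alpha>) A B"
  using assms functor_Arr[OF Src_functor, of \<alpha>] functor_Arr[OF Tgt_functor, of \<alpha>]
  by (auto simp: in_hom_def Src_HId Tgt_HId)

end

text \<open>The image of \<open>\<alpha>\<close> runs between the images of units, which are only
  isomorphic to units. Composing with \<open>DUnit F A\<close> and with an inverse of
  \<open>DUnit F B\<close> corrects this, and the sides stay the same because both cells are
  globular.\<close>

lemma pseudo_double_functor_unit_cell:
  assumes "pseudo_double_functor D K F" "unital_double_graph D" "unital_double_graph K"
    and A: "A \<in> Obj (VCat D)" and B: "B \<in> Obj (VCat D)"
    and \<alpha>: "in_hom (HCat D) \<alpha> (FObj (HId D) A) (FObj (HId D) B)"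
  obtains \<beta> where
    "in_hom (HCat K) \<beta> (FObj (HId K) (FObj (DF0 F) A)) (FObj (HId K) (FObj (DF0 F) B))"
    "FArr (Src K) \<beta> = FArr (DF0 F) (FArr (Src D) \<alpha>)"
    "FArr (Tgt K) \<beta> = FArr (DF0 F) (FArr (Tgt D) \<alpha>)"
proof -
  interpret F: pseudo_double_functor D K F by fact
  interpret D: unital_double_graph D by fact
  interpret K: unital_double_graph K by fact
  interpret VK: category "VCat K" by (rule K.VCat_category)
  interpret HK: category "HCat K" by (rule K.HCat_category)
  let ?IA = "FObj (HId K) (FObj (DF0 F) A)" and ?IB = "FObj (HId K) (FObj (DF0 F) B)"
  let ?FA = "FObj (DF1 F) (FObj (HId D) A)" and ?FB = "FObj (DF1 F) (FObj (HId D) B)"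
  have FAB: "FObj (DF0 F) A \<in> Obj (VCat K)" "FObj (DF0 F) B \<in> Obj (VCat K)"
    using A B functor_Obj[OF F.DF0_functor] by auto
  have unitA: "in_hom (HCat K) (DUnit F A) ?IA ?FA"
    "FArr (Src K) (DUnit F A) = Idn (VCat K) (FObj (DF0 F) A)"
    "FArr (Tgt K) (DUnit F A) = Idn (VCat K) (FObj (DF0 F) A)"
    using F.DUnit_iso[OF A] FAB by (auto simp: globular_iso_def K.Src_HId K.Tgt_HId)
  obtain \<delta> where unitB: "in_hom (HCat K) \<delta> ?FB ?IB"
    "FArr (Src K) \<delta> = Idn (VCat K) (FObj (DF0 F) B)"
    "FArr (Tgt K) \<delta> = Idn (VCat K) (FObj (DF0 F) B)"
    using K.globular_iso_inverse[OF F.DUnit_iso[OF B]] FAB by (auto simp: K.Src_HId K.Tgt_HId)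
  have \<alpha>_cell: "\<alpha> \<in> Cells D"
    using \<alpha> by (simp add: in_hom_def)
  have F\<alpha>: "in_hom (HCat K) (FArr (DF1 F) \<alpha>) ?FA ?FB"
    using F.DF1_functor \<alpha> unfolding is_functor_def by blast
  have sides: "in_hom (VCat K) (FArr (DF0 F) (FArr (Src D) \<alpha>)) (FObj (DF0 F) A) (FObj (DF0 F) B)"
    "in_hom (VCat K) (FArr (DF0 F) (FArr (Tgt D) \<alpha>)) (FObj (DF0 F) A) (FObj (DF0 F) B)"
    using D.unit_cell_sides[OF A B \<alpha>] F.DF0_functor unfolding is_functor_def by blast+
  let ?\<beta> = "\<delta> \<cdot>\<^bsub>HCat K\<^esub> (FArr (DF1 F) \<alpha> \<cdot>\<^bsub>HCat K\<^esub> DUnit F A)"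
  have comp: "FArr S ?\<beta> = FArr S \<delta> \<cdot>\<^bsub>VCat K\<^esub> (FArr S (FArr (DF1 F) \<alpha>) \<cdot>\<^bsub>VCat K\<^esub> FArr S (DUnit F A))"
    if "is_functor (HCat K) (VCat K) S" for S
    using unitA(1) unitB(1) F\<alpha> by (simp add: functor_Cmp[OF that] in_hom_def HK.arrow_simps)
  show thesis
  proof (rule that)
    show "in_hom (HCat K) ?\<beta> ?IA ?IB"
      using unitA(1) unitB(1) F\<alpha> by (simp add: in_hom_def HK.arrow_simps)
    show "FArr (Src K) ?\<beta> = FArr (DF0 F) (FArr (Src D) \<alpha>)"
      unfolding comp[OF K.Src_functor] using unitA(2) unitB(2) sides(1) F.DF_Src_arr[OF \<alpha>_cell]
      by (simp add: in_hom_def VK.arrow_simps)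
    show "FArr (Tgt K) ?\<beta> = FArr (DF0 F) (FArr (Tgt D) \<alpha>)"
      unfolding comp[OF K.Tgt_functor] using unitA(3) unitB(3) sides(2) F.DF_Tgt_arr[OF \<alpha>_cell]
      by (simp add: in_hom_def VK.arrow_simps)
  qed
qed

text \<open>Each half of local posetality uses one kind of faithfulness: on cells for the local
  preorder, on vertical arrows for antisymmetry. In the second half opposite unit cells are
  transferred to \<open>K\<close>, where the images of their sides must coincide.\<close>

lemma locally_posetal_reflect:
  assumes "pseudo_double_functor D K F" "unital_double_graph D" "unital_double_graph K"
    and faithful0: "faithful (VCat D) (VCat K) (DF0 F)"
    and faithful1: "faithful (HCat D) (HCat K) (DF1 F)"
    and K: "locally_posetal K"
  shows "locally_posetal D"
proof -
  interpret F: pseudo_double_functor D K F by fact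
  interpret D: unital_double_graph D by fact
  interpret K: unital_double_graph K by fact
  show ?thesis
    unfolding D.locally_posetal_iff
  proof (intro conjI ballI allI impI; (elim conjE)?)
    show "locally_preordered D"
      unfolding locally_preordered_def
    proof (intro allI impI, elim conjE)
      fix p q f g \<alpha> \<beta>
      assume \<alpha>: "in_hom (HCat D) \<alpha> p q" "FArr (Src D) \<alpha> = f" "FArr (Tgt D) \<alpha> = g"
        and \<beta>: "in_hom (HCat D) \<beta> p q" "FArr (Src D) \<beta> = f" "FArr (Tgt D) \<beta> = g"
      have "in_hom (HCat K) (FArr (DF1 F) \<alpha>) (FObj (DF1 F) p) (FObj (DF1 F) q)"
        "in_hom (HCat K) (FArr (DF1 F) \<beta>) (FObj (DF1 F) p) (FObj (DF1 F) q)"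
        using \<alpha> \<beta> F.DF1_functor unfolding is_functor_def by blast+
      moreover have "FArr (Src K) (FArr (DF1 F) \<alpha>) = FArr (Src K) (FArr (DF1 F) \<beta>)"
        "FArr (Tgt K) (FArr (DF1 F) \<alpha>) = FArr (Tgt K) (FArr (DF1 F) \<beta>)"
        using \<alpha> \<beta> by (simp_all add: F.DF_Src_arr F.DF_Tgt_arr in_hom_def)
      ultimately have "FArr (DF1 F) \<alpha> = FArr (DF1 F) \<beta>"
        using K unfolding locally_posetal_def locally_preordered_def by blast
      then show "\<alpha> = \<beta>"
        using \<alpha> \<beta> faithful1 unfolding faithful_def by blast
    qed
  next
    fix A B \<alpha> \<beta>
    assume A: "A \<in> Obj (VCat D)" and B: "B \<in> Obj (VCat D)"
      and \<alpha>: "in_hom (HCat D) \<alpha> (FObj (HId D) A) (FObj (HId D) B)"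
      and \<beta>: "in_hom (HCat D) \<beta> (FObj (HId D) A) (FObj (HId D) B)"
      and eq: "FArr (Src D) \<alpha> = FArr (Tgt D) \<beta>" "FArr (Tgt D) \<alpha> = FArr (Src D) \<beta>"
    note transfer = pseudo_double_functor_unit_cell[OF assms(1-3) A B]
    obtain \<alpha>' \<beta>' where
      "in_hom (HCat K) \<alpha>' (FObj (HId K) (FObj (DF0 F) A)) (FObj (HId K) (FObj (DF0 F) B))"
      "in_hom (HCat K) \<beta>' (FObj (HId K) (FObj (DF0 F) A)) (FObj (HId K) (FObj (DF0 F) B))"
      and sides: "FArr (Src K) \<alpha>' = FArr (DF0 F) (FArr (Src D) \<alpha>)"
      "FArr (Tgt K) \<alpha>' = FArr (DF0 F) (FArr (Tgt D) \<alpha>)"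
      "FArr (Src K) \<beta>' = FArr (DF0 F) (FArr (Src D) \<beta>)"
      "FArr (Tgt K) \<beta>' = FArr (DF0 F) (FArr (Tgt D) \<beta>)"
      using transfer[OF \<alpha>] transfer[OF \<beta>] by metis
    moreover have "FObj (DF0 F) A \<in> Obj (VCat K)" "FObj (DF0 F) B \<in> Obj (VCat K)"
      using A B functor_Obj[OF F.DF0_functor] by auto
    ultimately have "FArr (Src K) \<alpha>' = FArr (Tgt K) \<alpha>'"
      using K eq unfolding K.locally_posetal_iff by metis
    then have "FArr (DF0 F) (FArr (Src D) \<alpha>) = FArr (DF0 F) (FArr (Tgt D) \<alpha>)"
      by (simp add: sides)
    then show "FArr (Src D) \<alpha> = FArr (Tgt D) \<alpha>"
      using D.unit_cell_sides[OF A B \<alpha>] faithful0 unfolding faithful_def by blast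
  qed
qed

text \<open>An equivalence of double categories restricts to equivalences of the vertical categories
  and of the categories of cells, so both \<open>F\<close> and its pseudo-inverse are faithful at
  both levels and reflection works in either direction. The vertical equivalence is exported as
  well, since the factorisation system is transported along it.\<close>

lemma double_equivalence_locally_posetal_iff:
  assumes eqv: "double_equivalence D K F"
    and D: "unital_double_graph D" and K: "unital_double_graph K"
  shows "locally_posetal D \<longleftrightarrow> locally_posetal K"
    and "\<exists>G \<eta> \<eta>' \<epsilon> \<epsilon>'. equivalent_categories (VCat D) (VCat K) (DF0 F) G \<eta> \<eta>' \<epsilon> \<epsilon>'"
proof -
  interpret D: unital_double_graph D by fact
  interpret K: unital_double_graph K by fact
  obtain G \<eta> \<epsilon> where F: "pseudo_double_functor D K F" and G: "pseudo_double_functor K D G"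
    and \<eta>: "invertible_vertical_transformation D D (id_dftor D) (comp_dftor D G F) \<eta>"
    and \<epsilon>: "invertible_vertical_transformation K K (comp_dftor K F G) (id_dftor K) \<epsilon>"
    using eqv unfolding double_equivalence_def by blast
  interpret F: pseudo_double_functor D K F by fact
  interpret G: pseudo_double_functor K D G by fact
  obtain \<eta>' where \<eta>T: "vertical_transformation D D (id_dftor D) (comp_dftor D G F) \<eta>"
    and \<eta>'T: "vertical_transformation D D (comp_dftor D G F) (id_dftor D) \<eta>'"
    and \<eta>0: "\<forall>A\<in>Obj (VCat D). VT0 \<eta>' A \<cdot>\<^bsub>VCat D\<^esub> VT0 \<eta> A = Idn (VCat D) A \<and>
      VT0 \<eta> A \<cdot>\<^bsub>VCat D\<^esub> VT0 \<eta>' A = Idn (VCat D) (FObj (DF0 G) (FObj (DF0 F) A))"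
    and \<eta>1: "\<forall>p\<in>HArrows D. VT1 \<eta>' p \<cdot>\<^bsub>HCat D\<^esub> VT1 \<eta> p = Idn (HCat D) p \<and>
      VT1 \<eta> p \<cdot>\<^bsub>HCat D\<^esub> VT1 \<eta>' p = Idn (HCat D) (FObj (DF1 G) (FObj (DF1 F) p))"
    using \<eta> unfolding invertible_vertical_transformation_def
    by (auto simp: id_dftor_def comp_dftor_def id_ftor_def comp_ftor_def)
  obtain \<epsilon>' where \<epsilon>T: "vertical_transformation K K (comp_dftor K F G) (id_dftor K) \<epsilon>"
    and \<epsilon>'T: "vertical_transformation K K (id_dftor K) (comp_dftor K F G) \<epsilon>'"
    and \<epsilon>0: "\<forall>A\<in>Obj (VCat K). VT0 \<epsilon>' A \<cdot>\<^bsub>VCat K\<^esub> VT0 \<epsilon> A = Idn (VCat K) (FObj (DF0 F) (FObj (DF0 G) A)) \<and>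
      VT0 \<epsilon> A \<cdot>\<^bsub>VCat K\<^esub> VT0 \<epsilon>' A = Idn (VCat K) A"
    and \<epsilon>1: "\<forall>p\<in>HArrows K. VT1 \<epsilon>' p \<cdot>\<^bsub>HCat K\<^esub> VT1 \<epsilon> p = Idn (HCat K) (FObj (DF1 F) (FObj (DF1 G) p)) \<and>
      VT1 \<epsilon> p \<cdot>\<^bsub>HCat K\<^esub> VT1 \<epsilon>' p = Idn (HCat K) p"
    using \<epsilon> unfolding invertible_vertical_transformation_def
    by (auto simp: id_dftor_def comp_dftor_def id_ftor_def comp_ftor_def)
  have DFs: "DF0 (id_dftor X) = id_ftor" "DF1 (id_dftor X) = id_ftor"
    "DF0 (comp_dftor X P Q) = comp_ftor (DF0 P) (DF0 Q)"
    "DF1 (comp_dftor X P Q) = comp_ftor (DF1 P) (DF1 Q)" for X P Q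
    by (simp_all add: id_dftor_def comp_dftor_def)
  note nats =
    \<eta>T[THEN vertical_transformation.VT0_natural, unfolded DFs]
    \<eta>T[THEN vertical_transformation.VT1_natural, unfolded DFs]
    \<eta>'T[THEN vertical_transformation.VT0_natural, unfolded DFs]
    \<eta>'T[THEN vertical_transformation.VT1_natural, unfolded DFs]
    \<epsilon>T[THEN vertical_transformation.VT0_natural, unfolded DFs]
    \<epsilon>T[THEN vertical_transformation.VT1_natural, unfolded DFs]
    \<epsilon>'T[THEN vertical_transformation.VT0_natural, unfolded DFs]
    \<epsilon>'T[THEN vertical_transformation.VT1_natural, unfolded DFs]
  have vertical: "equivalent_categories (VCat D) (VCat K) (DF0 F) (DF0 G) (VT0 \<eta>) (VT0 \<eta>') (VT0 \<epsilon>) (VT0 \<epsilon>')"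
    unfolding equivalent_categories_def equivalent_categories_axioms_def
    using D.VCat_category K.VCat_category F.DF0_functor G.DF0_functor nats \<eta>0 \<epsilon>0
    by (auto simp: inverse_arrows_def natural_transformation_def in_hom_def id_ftor_def comp_ftor_def)
  have horizontal: "equivalent_categories (HCat D) (HCat K) (DF1 F) (DF1 G) (VT1 \<eta>) (VT1 \<eta>') (VT1 \<epsilon>) (VT1 \<epsilon>')"
    unfolding equivalent_categories_def equivalent_categories_axioms_def
    using D.HCat_category K.HCat_category F.DF1_functor G.DF1_functor nats \<eta>1 \<epsilon>1
    by (auto simp: inverse_arrows_def natural_transformation_def in_hom_def id_ftor_def comp_ftor_def)
  show "\<exists>G \<eta> \<eta>' \<epsilon> \<epsilon>'. equivalent_categories (VCat D) (VCat K) (DF0 F) G \<eta> \<eta>' \<epsilon> \<epsilon>'"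
    using vertical by blast
  show "locally_posetal D \<longleftrightarrow> locally_posetal K"
    using locally_posetal_reflect[OF F D K] locally_posetal_reflect[OF G K D]
      equivalent_categories.faithful_F[OF vertical] equivalent_categories.faithful_G[OF vertical]
      equivalent_categories.faithful_F[OF horizontal] equivalent_categories.faithful_G[OF horizontal]
    by blast
qed


section \<open>Local posetality of the double category of relations\<close>

context category
begin

lemma terminal_exists:
  assumes "has_finite_limits C"
  obtains T where "T \<in> Obj C" "\<And>X. X \<in> Obj C \<Longrightarrow> \<exists>!h. in_hom C h X T"
proof -
  define J :: "(nat, nat) cat" where
    "J = \<lparr>Obj = {}, Arr = {}, Dom = \<lambda>i. i, Cod = \<lambda>i. i, Idn = \<lambda>i. i, Cmp = \<lambda>j i. i\<rparr>"
  have "category J"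
    by unfold_locales (auto simp: J_def in_hom_def)
  moreover have "is_functor J C F" for F
    by (auto simp: J_def is_functor_def in_hom_def)
  \<comment> \<open>Any value is a functor on the empty category, so \<open>undefined\<close> can
    serve as the diagram.\<close>
  ultimately obtain T \<pi> where "is_limit J C undefined T \<pi>"
    using assms unfolding has_finite_limits_def by (force simp: J_def)
  moreover have "is_cone J C F X \<rho> \<longleftrightarrow> X \<in> Obj C" for F X \<rho>
    by (auto simp: J_def is_cone_def in_hom_def)
  ultimately show thesis
    using that unfolding is_limit_def by (force simp: J_def)
qed

lemma product_exists:
  assumes "has_finite_limits C" "A \<in> Obj C" "B \<in> Obj C"
  shows "\<exists>p q. is_product C A B p q"
proof -
  \<comment> \<open>The discrete category on two objects, with each number serving both as an object
    and as its identity arrow.\<close>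
  define J :: "(nat, nat) cat" where
    "J = \<lparr>Obj = {0, 1}, Arr = {0, 1}, Dom = \<lambda>i. i, Cod = \<lambda>i. i, Idn = \<lambda>i. i, Cmp = \<lambda>j i. i\<rparr>"
  define F where "F = \<lparr>FObj = \<lambda>i :: nat. if i = 0 then A else B,
    FArr = \<lambda>i :: nat. Idn C (if i = 0 then A else B)\<rparr>"
  have J: "in_hom J u j k \<longleftrightarrow> u \<in> {0, 1} \<and> j = u \<and> k = u" for u j k
    by (auto simp: J_def in_hom_def)
  have "category J"
    by unfold_locales (auto simp: J_def in_hom_def)
  moreover have "is_functor J C F"
    using assms(2,3) Cmp_Idn_right[OF Idn_hom]
    by (auto simp: is_functor_def J) (auto simp: F_def J_def Idn_hom)
  ultimately obtain L \<pi> where lim: "is_limit J C F L \<pi>"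
    using assms(1) unfolding has_finite_limits_def by (force simp: J_def)
  have cone: "is_cone J C F X \<rho> \<longleftrightarrow> X \<in> Obj C \<and> in_hom C (\<rho> 0) X A \<and> in_hom C (\<rho> 1) X B" for X \<rho>
    using Cmp_Idn_left[of "\<rho> 0" X A] Cmp_Idn_left[of "\<rho> 1" X B]
    by (auto simp: is_cone_def J) (auto simp: F_def J_def)
  have \<pi>: "in_hom C (\<pi> 0) L A" "in_hom C (\<pi> 1) L B"
    using lim by (auto simp: is_limit_def cone)
  have "is_product C A B (\<pi> 0) (\<pi> 1)"
    unfolding is_product_def
  proof (intro conjI allI impI; (elim conjE)?)
    fix X f g
    assume fg: "in_hom C f X A" "in_hom C g X B"
    then have "is_cone J C F X (\<lambda>i. if i = 0 then f else g)"
      using Dom_Obj by (auto simp: cone in_hom_def)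
    then have "\<exists>!h. in_hom C h X L \<and> (\<forall>j\<in>Obj J. \<pi> j \<cdot> h = (if j = 0 then f else g))"
      using lim unfolding is_limit_def by blast
    then show "\<exists>!h. in_hom C h X (Dom C (\<pi> 0)) \<and> \<pi> 0 \<cdot> h = f \<and> \<pi> 1 \<cdot> h = g"
      using \<pi>(1) by (simp add: J_def in_hom_def)
  qed (use \<pi> in \<open>auto simp: in_hom_def\<close>)
  then show ?thesis
    by blast
qed

end

section \<open>Chosen products, pairings and product arrows\<close>

locale relations = factorisation_system C E M for C :: "('o, 'a) cat" (structure) and E M +
  assumes finite_limits: "has_finite_limits C"
begin

abbreviation "\<pi>\<^sub>1 \<equiv> proj1 C"
abbreviation "\<pi>\<^sub>2 \<equiv> proj2 C"

lemma proj_product: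
  assumes "A \<in> Obj C" "B \<in> Obj C"
  shows "is_product C A B (\<pi>\<^sub>1 A B) (\<pi>\<^sub>2 A B)"
proof -
  have "\<exists>pq. case pq of (p, q) \<Rightarrow> is_product C A B p q"
    using product_exists[OF finite_limits assms] by auto
  from someI_ex[OF this] show ?thesis
    by (simp add: proj1_def proj2_def proj_def case_prod_unfold)
qed

lemma proj_hom:
  assumes "A \<in> Obj C" "B \<in> Obj C"
  shows "\<pi>\<^sub>1 A B \<in> Arr C" "Dom C (\<pi>\<^sub>1 A B) = prod_obj C A B" "Cod C (\<pi>\<^sub>1 A B) = A"
    "\<pi>\<^sub>2 A B \<in> Arr C" "Dom C (\<pi>\<^sub>2 A B) = prod_obj C A B" "Cod C (\<pi>\<^sub>2 A B) = B"
  using proj_product[OF assms] by (auto simp: is_product_def prod_obj_def in_hom_def)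

lemma prod_obj_Obj: "\<lbrakk>A \<in> Obj C; B \<in> Obj C\<rbrakk> \<Longrightarrow> prod_obj C A B \<in> Obj C"
  using proj_hom(1,2) Dom_Obj by metis

lemma product_ext:
  assumes "A \<in> Obj C" "B \<in> Obj C" "in_hom C h X (prod_obj C A B)" "in_hom C k X (prod_obj C A B)"
    "\<pi>\<^sub>1 A B \<cdot> h = \<pi>\<^sub>1 A B \<cdot> k" "\<pi>\<^sub>2 A B \<cdot> h = \<pi>\<^sub>2 A B \<cdot> k"
  shows "h = k"
proof -
  have "in_hom C (\<pi>\<^sub>1 A B \<cdot> k) X A" "in_hom C (\<pi>\<^sub>2 A B \<cdot> k) X B"
    using assms by (auto simp: in_hom_def proj_hom arrow_simps)
  then have "\<exists>!h. in_hom C h X (prod_obj C A B) \<and> \<pi>\<^sub>1 A B \<cdot> h = \<pi>\<^sub>1 A B \<cdot> k \<and> \<pi>\<^sub>2 A B \<cdot> h = \<pi>\<^sub>2 A B \<cdot> k"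
    using proj_product[OF assms(1,2)] unfolding is_product_def prod_obj_def by blast
  then show ?thesis
    using assms by blast
qed

lemma pairing:
  assumes "f \<in> Arr C" "g \<in> Arr C" "Dom C f = Dom C g"
  shows "pairing C f g \<in> Arr C" "Dom C (pairing C f g) = Dom C f"
    "Cod C (pairing C f g) = prod_obj C (Cod C f) (Cod C g)"
    "\<pi>\<^sub>1 (Cod C f) (Cod C g) \<cdot> pairing C f g = f" "\<pi>\<^sub>2 (Cod C f) (Cod C g) \<cdot> pairing C f g = g"
proof -
  have "in_hom C f (Dom C f) (Cod C f)" "in_hom C g (Dom C f) (Cod C g)"
    "is_product C (Cod C f) (Cod C g) (\<pi>\<^sub>1 (Cod C f) (Cod C g)) (\<pi>\<^sub>2 (Cod C f) (Cod C g))"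
    using assms proj_product Cod_Obj by (auto simp: in_hom_def)
  then have "\<exists>!h. in_hom C h (Dom C f) (prod_obj C (Cod C f) (Cod C g)) \<and>
    \<pi>\<^sub>1 (Cod C f) (Cod C g) \<cdot> h = f \<and> \<pi>\<^sub>2 (Cod C f) (Cod C g) \<cdot> h = g"
    unfolding is_product_def prod_obj_def by blast
  from theI'[OF this]
  show "pairing C f g \<in> Arr C" "Dom C (pairing C f g) = Dom C f"
    "Cod C (pairing C f g) = prod_obj C (Cod C f) (Cod C g)"
    "\<pi>\<^sub>1 (Cod C f) (Cod C g) \<cdot> pairing C f g = f" "\<pi>\<^sub>2 (Cod C f) (Cod C g) \<cdot> pairing C f g = g"
    unfolding pairing_def[symmetric] by (auto simp: in_hom_def)
qed

lemma prod_arr: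
  assumes "in_hom C f A A'" "in_hom C g B B'"
  shows "in_hom C (prod_arr C f g) (prod_obj C A B) (prod_obj C A' B')"
    "\<pi>\<^sub>1 A' B' \<cdot> prod_arr C f g = f \<cdot> \<pi>\<^sub>1 A B" "\<pi>\<^sub>2 A' B' \<cdot> prod_arr C f g = g \<cdot> \<pi>\<^sub>2 A B"
proof -
  have fg: "f \<in> Arr C" "g \<in> Arr C" "Dom C f = A" "Cod C f = A'" "Dom C g = B" "Cod C g = B'"
    "A \<in> Obj C" "B \<in> Obj C"
    using assms Dom_Obj by (auto simp: in_hom_def)
  then show "in_hom C (prod_arr C f g) (prod_obj C A B) (prod_obj C A' B')"
    "\<pi>\<^sub>1 A' B' \<cdot> prod_arr C f g = f \<cdot> \<pi>\<^sub>1 A B" "\<pi>\<^sub>2 A' B' \<cdot> prod_arr C f g = g \<cdot> \<pi>\<^sub>2 A B"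
    using pairing[of "f \<cdot> \<pi>\<^sub>1 A B" "g \<cdot> \<pi>\<^sub>2 A B"]
    by (simp_all add: prod_arr_def in_hom_def proj_hom arrow_simps)
qed

lemma prod_arr_Arr:
  assumes "f \<in> Arr C" "g \<in> Arr C"
  shows "prod_arr C f g \<in> Arr C" "Dom C (prod_arr C f g) = prod_obj C (Dom C f) (Dom C g)"
    "Cod C (prod_arr C f g) = prod_obj C (Cod C f) (Cod C g)"
  using prod_arr(1)[of f "Dom C f" "Cod C f" g "Dom C g" "Cod C g"] assms by (auto simp: in_hom_def)

text \<open>Composites are normalised to right-nested form, where a projection meets a product arrow
  only in front of a further arrow \<open>x\<close>; hence the extra argument.\<close>

lemma proj_prod_arr_Cmp:
  assumes "f \<in> Arr C" "g \<in> Arr C" "x \<in> Arr C" "Cod C x = prod_obj C (Dom C f) (Dom C g)"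
    "Cod C f = A'" "Cod C g = B'"
  shows "\<pi>\<^sub>1 A' B' \<cdot> (prod_arr C f g \<cdot> x) = f \<cdot> (\<pi>\<^sub>1 (Dom C f) (Dom C g) \<cdot> x)"
    "\<pi>\<^sub>2 A' B' \<cdot> (prod_arr C f g \<cdot> x) = g \<cdot> (\<pi>\<^sub>2 (Dom C f) (Dom C g) \<cdot> x)"
proof -
  have obj: "Dom C f \<in> Obj C" "Dom C g \<in> Obj C" "A' \<in> Obj C" "B' \<in> Obj C"
    using assms Dom_Obj Cod_Obj by auto
  note pa = prod_arr[of f "Dom C f" A' g "Dom C g" B']
  have "\<pi>\<^sub>1 A' B' \<cdot> prod_arr C f g \<cdot> x = f \<cdot> \<pi>\<^sub>1 (Dom C f) (Dom C g) \<cdot> x"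
    "\<pi>\<^sub>2 A' B' \<cdot> prod_arr C f g \<cdot> x = g \<cdot> \<pi>\<^sub>2 (Dom C f) (Dom C g) \<cdot> x"
    using pa assms by (simp_all add: in_hom_def)
  then show "\<pi>\<^sub>1 A' B' \<cdot> (prod_arr C f g \<cdot> x) = f \<cdot> (\<pi>\<^sub>1 (Dom C f) (Dom C g) \<cdot> x)"
    "\<pi>\<^sub>2 A' B' \<cdot> (prod_arr C f g \<cdot> x) = g \<cdot> (\<pi>\<^sub>2 (Dom C f) (Dom C g) \<cdot> x)"
    using assms obj by (simp_all add: Cmp_Cmp prod_arr_Arr proj_hom)
qed

lemma prod_arr_Idn:
  assumes "A \<in> Obj C" "B \<in> Obj C"
  shows "prod_arr C (Idn C A) (Idn C B) = Idn C (prod_obj C A B)"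
  using assms prod_arr[OF Idn_hom Idn_hom, of A B] prod_obj_Obj[OF assms]
  by - (rule product_ext[OF assms], auto simp: in_hom_def proj_hom arrow_simps)

lemma prod_arr_Cmp:
  assumes "in_hom C f A A'" "in_hom C f' A' A''" "in_hom C g B B'" "in_hom C g' B' B''"
  shows "prod_arr C (f' \<cdot> f) (g' \<cdot> g) = prod_arr C f' g' \<cdot> prod_arr C f g"
proof -
  have obj: "A \<in> Obj C" "B \<in> Obj C" "A' \<in> Obj C" "B' \<in> Obj C" "A'' \<in> Obj C" "B'' \<in> Obj C"
    using assms Dom_Obj Cod_Obj by (auto simp: in_hom_def)
  have hom: "f \<in> Arr C" "f' \<in> Arr C" "g \<in> Arr C" "g' \<in> Arr C"
    "Dom C f = A" "Cod C f = A'" "Dom C f' = A'" "Cod C f' = A''"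
    "Dom C g = B" "Cod C g = B'" "Dom C g' = B'" "Cod C g' = B''"
    using assms by (auto simp: in_hom_def)
  have comp: "in_hom C (f' \<cdot> f) A A''" "in_hom C (g' \<cdot> g) B B''"
    using hom by (auto simp: in_hom_def arrow_simps)
  show ?thesis
    using prod_arr[OF comp] prod_arr[OF assms(1,3)] hom obj
    by - (rule product_ext[OF obj(5,6)],
        auto simp: proj_prod_arr_Cmp prod_arr_Arr in_hom_def proj_hom arrow_simps)
qed

section \<open>The category of relations and their cells\<close>

lemma rel_hcat_in_hom:
  "in_hom (rel_hcat C M) \<alpha> R S \<longleftrightarrow> is_rel_cell C M \<alpha> \<and> cell_dom \<alpha> = R \<and> cell_cod \<alpha> = S"
  by (simp add: in_hom_def rel_hcat_def)

lemma rel_cell_hom: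
  assumes "is_rel C M R" "is_rel C M S" "in_hom C f (left_obj R) (left_obj S)"
    "in_hom C g (right_obj R) (right_obj S)" "in_hom C d (apex C R) (apex C S)"
    "rel_arr S \<cdot> d = prod_arr C f g \<cdot> rel_arr R"
  shows "in_hom (rel_hcat C M)
    \<lparr>cell_dom = R, cell_cod = S, cell_left = f, cell_right = g, cell_arr = d\<rparr> R S"
  using assms by (simp add: rel_hcat_in_hom is_rel_cell_def)

lemma rel_hcat_homD:
  assumes "in_hom (rel_hcat C M) \<alpha> R S"
  shows "is_rel C M R" "is_rel C M S" "in_hom C (cell_left \<alpha>) (left_obj R) (left_obj S)"
    "in_hom C (cell_right \<alpha>) (right_obj R) (right_obj S)" "in_hom C (cell_arr \<alpha>) (apex C R) (apex C S)"
    "rel_arr S \<cdot> cell_arr \<alpha> = prod_arr C (cell_left \<alpha>) (cell_right \<alpha>) \<cdot> rel_arr R"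
    "cell_dom \<alpha> = R" "cell_cod \<alpha> = S"
  using assms by (auto simp: rel_hcat_in_hom is_rel_cell_def)

lemma rel_hcat_category: "category (rel_hcat C M)"
proof
  fix \<alpha> X Y
  assume \<alpha>: "in_hom (rel_hcat C M) \<alpha> X Y"
  note homs = rel_hcat_homD(3-5,7,8)[OF \<alpha>, unfolded in_hom_def]
  show "\<alpha> \<cdot>\<^bsub>rel_hcat C M\<^esub> Idn (rel_hcat C M) X = \<alpha>" "Idn (rel_hcat C M) Y \<cdot>\<^bsub>rel_hcat C M\<^esub> \<alpha> = \<alpha>"
    using homs by (simp_all add: rel_hcat_def Cmp_Idn_Dom Cmp_Idn_Cod)
next
  fix R
  assume "R \<in> Obj (rel_hcat C M)"
  then have R: "is_rel C M R"
    by (simp add: rel_hcat_def)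
  then have "in_hom (rel_hcat C M) \<lparr>cell_dom = R, cell_cod = R, cell_left = Idn C (left_obj R),
      cell_right = Idn C (right_obj R), cell_arr = Idn C (apex C R)\<rparr> R R"
    by (intro rel_cell_hom) (simp_all add: is_rel_def in_hom_def apex_def prod_arr_Idn arrow_simps)
  then show "in_hom (rel_hcat C M) (Idn (rel_hcat C M) R) R R"
    by (simp add: rel_hcat_def)
next
  fix \<alpha> \<beta> X Y Z
  assume \<alpha>: "in_hom (rel_hcat C M) \<alpha> X Y" and \<beta>: "in_hom (rel_hcat C M) \<beta> Y Z"
  note \<alpha>D = rel_hcat_homD[OF \<alpha>] and \<beta>D = rel_hcat_homD[OF \<beta>]
  note homs = \<alpha>D(3-5)[unfolded in_hom_def] \<beta>D(3-5)[unfolded in_hom_def]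
    \<alpha>D(1)[unfolded is_rel_def] \<beta>D(1,2)[unfolded is_rel_def]
  have "rel_arr Z \<cdot> (cell_arr \<beta> \<cdot> cell_arr \<alpha>) = (rel_arr Z \<cdot> cell_arr \<beta>) \<cdot> cell_arr \<alpha>"
    using homs by (simp add: Cmp_Cmp apex_def)
  also have "\<dots> = prod_arr C (cell_left \<beta>) (cell_right \<beta>) \<cdot> (rel_arr Y \<cdot> cell_arr \<alpha>)"
    unfolding \<beta>D(6) using homs by (simp add: Cmp_Cmp apex_def prod_arr_Arr)
  also have "\<dots> = (prod_arr C (cell_left \<beta>) (cell_right \<beta>) \<cdot> prod_arr C (cell_left \<alpha>) (cell_right \<alpha>)) \<cdot> rel_arr X"
    unfolding \<alpha>D(6) using homs by (simp add: Cmp_Cmp prod_arr_Arr)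
  also have "\<dots> = prod_arr C (cell_left \<beta> \<cdot> cell_left \<alpha>) (cell_right \<beta> \<cdot> cell_right \<alpha>) \<cdot> rel_arr X"
    using prod_arr_Cmp[OF \<alpha>D(3) \<beta>D(3) \<alpha>D(4) \<beta>D(4)] by simp
  finally have "in_hom (rel_hcat C M) \<lparr>cell_dom = X, cell_cod = Z,
      cell_left = cell_left \<beta> \<cdot> cell_left \<alpha>, cell_right = cell_right \<beta> \<cdot> cell_right \<alpha>,
      cell_arr = cell_arr \<beta> \<cdot> cell_arr \<alpha>\<rparr> X Z"
    using \<alpha>D \<beta>D by (intro rel_cell_hom Cmp_hom) auto
  then show "in_hom (rel_hcat C M) (\<beta> \<cdot>\<^bsub>rel_hcat C M\<^esub> \<alpha>) X Z"
    using \<alpha>D(7) \<beta>D(8) by (simp add: rel_hcat_def)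
next
  fix \<alpha> \<beta> \<gamma> W X Y Z
  assume "in_hom (rel_hcat C M) \<alpha> W X" "in_hom (rel_hcat C M) \<beta> X Y" "in_hom (rel_hcat C M) \<gamma> Y Z"
  note homs = this[THEN rel_hcat_homD(3), unfolded in_hom_def] this[THEN rel_hcat_homD(4), unfolded in_hom_def]
    this[THEN rel_hcat_homD(5), unfolded in_hom_def]
  show "\<gamma> \<cdot>\<^bsub>rel_hcat C M\<^esub> (\<beta> \<cdot>\<^bsub>rel_hcat C M\<^esub> \<alpha>) = (\<gamma> \<cdot>\<^bsub>rel_hcat C M\<^esub> \<beta>) \<cdot>\<^bsub>rel_hcat C M\<^esub> \<alpha>"
    using homs by (simp add: rel_hcat_def Cmp_Cmp)
qed (auto simp: rel_hcat_def is_rel_cell_def)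

lemma Rel_simps [simp]:
  "VCat (Rel C E M) = C" "HCat (Rel C E M) = rel_hcat C M"
  "FObj (Src (Rel C E M)) = left_obj" "FArr (Src (Rel C E M)) = cell_left"
  "FObj (Tgt (Rel C E M)) = right_obj" "FArr (Tgt (Rel C E M)) = cell_right"
  "FObj (HId (Rel C E M)) = rel_id C E M"
  by (simp_all add: Rel_def)

section \<open>Identity relations\<close>

lemma diagonal:
  assumes "A \<in> Obj C"
  shows "diagonal C A \<in> Arr C" "Dom C (diagonal C A) = A" "Cod C (diagonal C A) = prod_obj C A A"
    "\<pi>\<^sub>1 A A \<cdot> diagonal C A = Idn C A" "\<pi>\<^sub>2 A A \<cdot> diagonal C A = Idn C A"
  using pairing[of "Idn C A" "Idn C A"] assms by (simp_all add: diagonal_def arrow_simps)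

lemma fact_factorisation:
  assumes "f \<in> Arr C"
  shows "Epart C E M f \<in> E" "Mpart C E M f \<in> M" "Cod C (Epart C E M f) = Dom C (Mpart C E M f)"
    "Mpart C E M f \<cdot> Epart C E M f = f"
proof -
  have "\<exists>em. case em of (e, m) \<Rightarrow> is_factorisation C E M f e m"
    using factorisation_exists[OF assms] by auto
  from someI_ex[OF this]
  show "Epart C E M f \<in> E" "Mpart C E M f \<in> M" "Cod C (Epart C E M f) = Dom C (Mpart C E M f)"
    "Mpart C E M f \<cdot> Epart C E M f = f"
    by (simp_all add: Epart_def Mpart_def fact_def is_factorisation_def case_prod_unfold)
qed

abbreviation "I\<^sub>m A \<equiv> rel_arr (rel_id C E M A)"
abbreviation "I\<^sub>e A \<equiv> id_cover C E M A"

lemma rel_id: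
  assumes "A \<in> Obj C"
  shows "I\<^sub>e A \<in> E" "I\<^sub>m A \<in> M" "I\<^sub>e A \<in> Arr C" "I\<^sub>m A \<in> Arr C" "Dom C (I\<^sub>e A) = A"
    "Cod C (I\<^sub>e A) = Dom C (I\<^sub>m A)" "Cod C (I\<^sub>m A) = prod_obj C A A" "I\<^sub>m A \<cdot> I\<^sub>e A = diagonal C A"
    "left_obj (rel_id C E M A) = A" "right_obj (rel_id C E M A) = A"
proof -
  note f = fact_factorisation[OF diagonal(1)[OF assms]]
  show *: "I\<^sub>e A \<in> E" "I\<^sub>m A \<in> M" "I\<^sub>e A \<in> Arr C" "I\<^sub>m A \<in> Arr C" "Cod C (I\<^sub>e A) = Dom C (I\<^sub>m A)"
    "I\<^sub>m A \<cdot> I\<^sub>e A = diagonal C A" "left_obj (rel_id C E M A) = A" "right_obj (rel_id C E M A) = A"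
    using f E_Arr M_Arr by (auto simp: rel_id_def id_cover_def)
  show "Dom C (I\<^sub>e A) = A" "Cod C (I\<^sub>m A) = prod_obj C A A"
    using Dom_Cmp[OF *(3,4,5)] Cod_Cmp[OF *(3,4,5)] diagonal[OF assms] *(6) by simp_all
qed

lemma is_rel_rel_id: "A \<in> Obj C \<Longrightarrow> is_rel C M (rel_id C E M A)"
  by (simp add: is_rel_def rel_id)

text \<open>The cover is a common section of the two legs of the identity relation. If it is also
  epi, the legs must agree.\<close>

lemma proj_rel_id_cover:
  assumes "A \<in> Obj C"
  shows "\<pi>\<^sub>1 A A \<cdot> I\<^sub>m A \<cdot> I\<^sub>e A = Idn C A" "\<pi>\<^sub>2 A A \<cdot> I\<^sub>m A \<cdot> I\<^sub>e A = Idn C A"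
  using assms diagonal[OF assms] by (simp_all add: rel_id Cmp_Cmp proj_hom)

lemma unital_double_graph_Rel: "unital_double_graph (Rel C E M)"
proof (rule unital_double_graph.intro)
  show "category (VCat (Rel C E M))" "category (HCat (Rel C E M))"
    using category_axioms rel_hcat_category by simp_all
  show "is_functor (HCat (Rel C E M)) (VCat (Rel C E M)) (Src (Rel C E M))"
    "is_functor (HCat (Rel C E M)) (VCat (Rel C E M)) (Tgt (Rel C E M))"
    by (auto simp: is_functor_def in_hom_def rel_hcat_def is_rel_cell_def is_rel_def)
qed (simp_all add: rel_id)

text \<open>For the direction from left to right, \<open>m : X \<rightarrow> Y\<close> in \<open>M\<close> and the identity of \<open>Z\<close> are regarded
  as relations to the terminal object; arrows \<open>u, v : Z \<rightarrow> X\<close> identified by \<open>m\<close> are parallel cells.\<close>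

lemma locally_preordered_Rel_iff: "locally_preordered (Rel C E M) \<longleftrightarrow> (\<forall>m\<in>M. is_mono C m)"
proof
  assume mono: "\<forall>m\<in>M. is_mono C m"
  show "locally_preordered (Rel C E M)"
    unfolding locally_preordered_def
  proof (intro allI impI, elim conjE)
    fix R S f g \<alpha> \<beta>
    assume \<alpha>: "in_hom (HCat (Rel C E M)) \<alpha> R S" and \<beta>: "in_hom (HCat (Rel C E M)) \<beta> R S"
      and sides: "FArr (Src (Rel C E M)) \<alpha> = f" "FArr (Tgt (Rel C E M)) \<alpha> = g"
        "FArr (Src (Rel C E M)) \<beta> = f" "FArr (Tgt (Rel C E M)) \<beta> = g"
    note \<alpha>D = rel_hcat_homD[OF \<alpha>[simplified]] and \<beta>D = rel_hcat_homD[OF \<beta>[simplified]]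
    have "is_mono C (rel_arr S)"
      using mono \<alpha>D(2) by (simp add: is_rel_def)
    moreover have "rel_arr S \<cdot> cell_arr \<alpha> = rel_arr S \<cdot> cell_arr \<beta>"
      using \<alpha>D(6) \<beta>D(6) sides by simp
    ultimately have "cell_arr \<alpha> = cell_arr \<beta>"
      using \<alpha>D(5) \<beta>D(5) unfolding is_mono_def apex_def by blast
    then show "\<alpha> = \<beta>"
      using \<alpha>D(7,8) \<beta>D(7,8) sides by simp
  qed
next
  assume preord: "locally_preordered (Rel C E M)"
  show "\<forall>m\<in>M. is_mono C m"
  proof
    fix m assume m: "m \<in> M"
    obtain T where T: "T \<in> Obj C" and terminal: "\<And>X. X \<in> Obj C \<Longrightarrow> \<exists>!h. in_hom C h X T"
      using terminal_exists[OF finite_limits] by blast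
    \<comment> \<open>Relations are arrows into a product, so \<open>m\<close> has to be composed
      with an isomorphism from \<open>Y\<close> to \<open>Y \<times> T\<close>. Such an inverse of
      the projection exists since \<open>T\<close> is terminal, and it lies in \<open>M\<close>
      because every isomorphism does.\<close>
    have proj_inverse: "\<exists>i. inverse_arrows C i (\<pi>\<^sub>1 Y T)" if Y: "Y \<in> Obj C" for Y
    proof -
      obtain t where t: "in_hom C t Y T"
        using terminal[OF Y] by blast
      let ?i = "pairing C (Idn C Y) t"
      have i: "?i \<in> Arr C" "Dom C ?i = Y" "Cod C ?i = prod_obj C Y T" "\<pi>\<^sub>1 Y T \<cdot> ?i = Idn C Y"
        using pairing[of "Idn C Y" t] t Y by (auto simp: in_hom_def arrow_simps)
      have YT: "prod_obj C Y T \<in> Obj C"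
        using prod_obj_Obj[OF Y T] .
      have "?i \<cdot> \<pi>\<^sub>1 Y T = Idn C (prod_obj C Y T)"
      proof (rule product_ext[OF Y T])
        show "\<pi>\<^sub>1 Y T \<cdot> (?i \<cdot> \<pi>\<^sub>1 Y T) = \<pi>\<^sub>1 Y T \<cdot> Idn C (prod_obj C Y T)"
          using Cmp_Cmp[of "\<pi>\<^sub>1 Y T" ?i "\<pi>\<^sub>1 Y T"] i Y T
          by (simp add: proj_hom Cmp_Idn_Dom Cmp_Idn_Cod)
        have "in_hom C (\<pi>\<^sub>2 Y T \<cdot> (?i \<cdot> \<pi>\<^sub>1 Y T)) (prod_obj C Y T) T"
          "in_hom C (\<pi>\<^sub>2 Y T \<cdot> Idn C (prod_obj C Y T)) (prod_obj C Y T) T"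
          using i Y T YT by (simp_all add: in_hom_def proj_hom arrow_simps)
        then show "\<pi>\<^sub>2 Y T \<cdot> (?i \<cdot> \<pi>\<^sub>1 Y T) = \<pi>\<^sub>2 Y T \<cdot> Idn C (prod_obj C Y T)"
          using terminal[OF YT] by blast
      qed (use i Y T YT in \<open>simp_all add: in_hom_def proj_hom arrow_simps\<close>)
      then have "inverse_arrows C ?i (\<pi>\<^sub>1 Y T)"
        using i Y T by (simp add: inverse_arrows_def in_hom_def proj_hom)
      then show ?thesis ..
    qed
    define X Y where "X = Dom C m" and "Y = Cod C m"
    have mXY: "m \<in> Arr C" "X \<in> Obj C" "Y \<in> Obj C"
      using m M_Arr Dom_Obj Cod_Obj by (auto simp: X_def Y_def)
    show "is_mono C m"
      unfolding is_mono_def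
    proof (intro conjI allI impI, fact, elim conjE)
      fix Z u v
      assume "in_hom C u Z (Dom C m)" "in_hom C v Z (Dom C m)" and eq: "m \<cdot> u = m \<cdot> v"
      then have uv: "u \<in> Arr C" "v \<in> Arr C" "Dom C u = Z" "Dom C v = Z" "Cod C u = X" "Cod C v = X"
        and Z: "Z \<in> Obj C"
        using Dom_Obj by (auto simp: in_hom_def X_def)
      obtain i where i: "inverse_arrows C i (\<pi>\<^sub>1 Y T)"
        using proj_inverse[OF mXY(3)] by blast
      obtain k where k: "inverse_arrows C k (\<pi>\<^sub>1 Z T)"
        using proj_inverse[OF Z] by blast
      have ik: "i \<in> Arr C" "Dom C i = Y" "Cod C i = prod_obj C Y T"
        "k \<in> Arr C" "Dom C k = Z" "Cod C k = prod_obj C Z T"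
        using inverse_arrowsD[OF i] inverse_arrowsD[OF k] mXY Z T by (auto simp: proj_hom)
      define S where "S = \<lparr>left_obj = Y, right_obj = T, rel_arr = i \<cdot> m\<rparr>"
      define R where "R = \<lparr>left_obj = Z, right_obj = T, rel_arr = k\<rparr>"
      have im: "i \<cdot> m \<in> M" "i \<cdot> m \<in> Arr C" "Dom C (i \<cdot> m) = X" "Cod C (i \<cdot> m) = prod_obj C Y T"
        using M_Cmp[OF m M_iso[OF i]] ik mXY by (simp_all add: arrow_simps X_def Y_def)
      have rels: "is_rel C M R" "is_rel C M S"
        using im ik M_iso[OF k] mXY Z T by (simp_all add: is_rel_def R_def S_def)
      \<comment> \<open>The left side is fixed as \<open>m \<cdot> u\<close> and does not mention
        \<open>w\<close>. Thus \<open>cell u\<close> and \<open>cell v\<close> have the same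
        boundary and differ at most in the component \<open>cell_arr\<close>, from which
        \<open>u = v\<close> is read off.\<close>
      define cell where "cell w = \<lparr>cell_dom = R, cell_cod = S, cell_left = m \<cdot> u,
        cell_right = Idn C T, cell_arr = w\<rparr>" for w
      have "in_hom (rel_hcat C M) (cell w) R S"
        if w: "w \<in> Arr C" "Dom C w = Z" "Cod C w = X" "m \<cdot> w = m \<cdot> u" for w
        unfolding cell_def
      proof (rule rel_cell_hom[OF rels])
        have mu: "m \<cdot> u \<in> Arr C" "Dom C (m \<cdot> u) = Z" "Cod C (m \<cdot> u) = Y"
          using uv mXY by (simp_all add: arrow_simps X_def Y_def)
        have L: "(i \<cdot> m) \<cdot> w = i \<cdot> (m \<cdot> u)"
          using w ik mXY by (simp add: Cmp_Cmp X_def Y_def flip: w(4))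
        note hom = im mu ik Idn_Arr[OF T] Dom_Idn[OF T] Cod_Idn[OF T] prod_arr_Arr proj_hom[OF mXY(3) T]
        have "i \<cdot> (m \<cdot> u) = prod_arr C (m \<cdot> u) (Idn C T) \<cdot> k"
        proof (rule product_ext[OF mXY(3) T])
          show "in_hom C (i \<cdot> (m \<cdot> u)) Z (prod_obj C Y T)"
            "in_hom C (prod_arr C (m \<cdot> u) (Idn C T) \<cdot> k) Z (prod_obj C Y T)"
            using hom by (simp_all add: in_hom_def Cmp_Arr Dom_Cmp Cod_Cmp)
          have "\<pi>\<^sub>1 Y T \<cdot> (i \<cdot> (m \<cdot> u)) = m \<cdot> u"
            using inverse_cancel(1)[OF i] hom by simp
          moreover have "\<pi>\<^sub>1 Y T \<cdot> (prod_arr C (m \<cdot> u) (Idn C T) \<cdot> k) = m \<cdot> u"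
            using hom inverse_arrowsD(5)[OF k] by (simp add: proj_prod_arr_Cmp Cmp_Idn_Dom)
          ultimately show "\<pi>\<^sub>1 Y T \<cdot> (i \<cdot> (m \<cdot> u)) = \<pi>\<^sub>1 Y T \<cdot> (prod_arr C (m \<cdot> u) (Idn C T) \<cdot> k)"
            by simp
          have "in_hom C (\<pi>\<^sub>2 Y T \<cdot> (i \<cdot> (m \<cdot> u))) Z T"
            "in_hom C (\<pi>\<^sub>2 Y T \<cdot> (prod_arr C (m \<cdot> u) (Idn C T) \<cdot> k)) Z T"
            using hom by (simp_all add: in_hom_def Cmp_Arr Dom_Cmp Cod_Cmp)
          then show "\<pi>\<^sub>2 Y T \<cdot> (i \<cdot> (m \<cdot> u)) = \<pi>\<^sub>2 Y T \<cdot> (prod_arr C (m \<cdot> u) (Idn C T) \<cdot> k)"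
            using terminal[OF Z] by blast
        qed
        then show "rel_arr S \<cdot> w = prod_arr C (m \<cdot> u) (Idn C T) \<cdot> rel_arr R"
          by (simp add: R_def S_def L)
        show "in_hom C (m \<cdot> u) (left_obj R) (left_obj S)"
          "in_hom C (Idn C T) (right_obj R) (right_obj S)" "in_hom C w (apex C R) (apex C S)"
          using hom w by (simp_all add: in_hom_def R_def S_def apex_def)
      qed
      from this[of u] this[of v]
      have "in_hom (rel_hcat C M) (cell u) R S" "in_hom (rel_hcat C M) (cell v) R S"
        using uv eq by simp_all
      then have "cell u = cell v"
        using preord[unfolded locally_preordered_def, rule_format,
            of "cell u" R S "m \<cdot> u" "Idn C T" "cell v"]
        by (simp add: cell_def)
      then show "u = v"
        by (simp add: cell_def)
    qed
  qed
qed

text \<open>The required arrow starts at the apex of the identity relation on \<open>Y\<close>, so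
  \<open>e\<close> is extended by the cover \<open>I\<^sub>e Y\<close> to an arrow of
  \<open>E\<close> ending there. Because \<open>f\<close> and \<open>g\<close> agree after
  \<open>e\<close>, the pair they induce on \<open>Dom C e\<close> factors through the diagonal of
  \<open>Z\<close>; this gives a square against \<open>I\<^sub>m Z\<close>, and its filler is the
  cell.\<close>

lemma unit_cell_from_coequalising:
  assumes e: "e \<in> E" and f: "in_hom C f (Cod C e) Z" and g: "in_hom C g (Cod C e) Z" and eq: "f \<cdot> e = g \<cdot> e"
  obtains \<alpha> where "in_hom (rel_hcat C M) \<alpha> (rel_id C E M (Cod C e)) (rel_id C E M Z)"
    "cell_left \<alpha> = f" "cell_right \<alpha> = g"
proof -
  define Y where "Y = Cod C e"
  have Y: "Y \<in> Obj C" and Z: "Z \<in> Obj C" and e_Arr: "e \<in> Arr C"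
    using e f E_Arr Cod_Obj by (auto simp: in_hom_def Y_def)
  have fg: "f \<in> Arr C" "Dom C f = Y" "Cod C f = Z" "g \<in> Arr C" "Dom C g = Y" "Cod C g = Z"
    using f g by (auto simp: in_hom_def Y_def)
  note IY = rel_id(3-7)[OF Y] and IZ = rel_id(3-7)[OF Z]
  note hom = e_Arr Y_def[symmetric] fg Y Z IY IZ prod_arr_Arr proj_hom[OF Z Z] proj_hom[OF Y Y]
    diagonal[OF Z] diagonal[OF Y]
  \<comment> \<open>Compared by projections: the first coordinates are both
    \<open>f \<cdot> e\<close>, and only the second ones, \<open>f \<cdot> e\<close> and
    \<open>g \<cdot> e\<close>, depend on the coequalising equation.\<close>
  have *: "diagonal C Z \<cdot> (f \<cdot> e) = prod_arr C f g \<cdot> (diagonal C Y \<cdot> e)"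
  proof (rule product_ext[OF Z Z])
    show "in_hom C (diagonal C Z \<cdot> (f \<cdot> e)) (Dom C e) (prod_obj C Z Z)"
      "in_hom C (prod_arr C f g \<cdot> (diagonal C Y \<cdot> e)) (Dom C e) (prod_obj C Z Z)"
      using hom by (simp_all add: in_hom_def Cmp_Arr Dom_Cmp Cod_Cmp)
    have Y1: "\<pi>\<^sub>1 Y Y \<cdot> (diagonal C Y \<cdot> e) = e" "\<pi>\<^sub>2 Y Y \<cdot> (diagonal C Y \<cdot> e) = e"
      using Cmp_Cmp[of e "diagonal C Y" "\<pi>\<^sub>1 Y Y"] Cmp_Cmp[of e "diagonal C Y" "\<pi>\<^sub>2 Y Y"] hom
      by (simp_all add: Cmp_Idn_Cod)
    have Z1: "\<pi>\<^sub>1 Z Z \<cdot> (diagonal C Z \<cdot> (f \<cdot> e)) = f \<cdot> e" "\<pi>\<^sub>2 Z Z \<cdot> (diagonal C Z \<cdot> (f \<cdot> e)) = f \<cdot> e"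
      using Cmp_Cmp[of "f \<cdot> e" "diagonal C Z" "\<pi>\<^sub>1 Z Z"] Cmp_Cmp[of "f \<cdot> e" "diagonal C Z" "\<pi>\<^sub>2 Z Z"] hom
      by (simp_all add: Cmp_Idn_Cod Cmp_Arr Dom_Cmp Cod_Cmp)
    show "\<pi>\<^sub>1 Z Z \<cdot> (diagonal C Z \<cdot> (f \<cdot> e)) = \<pi>\<^sub>1 Z Z \<cdot> (prod_arr C f g \<cdot> (diagonal C Y \<cdot> e))"
      unfolding Z1 using hom Y1 by (simp add: proj_prod_arr_Cmp Cmp_Arr Cod_Cmp)
    show "\<pi>\<^sub>2 Z Z \<cdot> (diagonal C Z \<cdot> (f \<cdot> e)) = \<pi>\<^sub>2 Z Z \<cdot> (prod_arr C f g \<cdot> (diagonal C Y \<cdot> e))"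
      unfolding Z1 using hom Y1 eq by (simp add: proj_prod_arr_Cmp Cmp_Arr Cod_Cmp)
  qed
  have "I\<^sub>m Z \<cdot> (I\<^sub>e Z \<cdot> (f \<cdot> e)) = I\<^sub>m Z \<cdot> I\<^sub>e Z \<cdot> (f \<cdot> e)"
    using hom by (simp add: Cmp_Arr Dom_Cmp Cod_Cmp Cmp_Cmp)
  also have "\<dots> = prod_arr C f g \<cdot> (I\<^sub>m Y \<cdot> I\<^sub>e Y \<cdot> e)"
    using * rel_id(8)[OF Y] rel_id(8)[OF Z] by simp
  also have "\<dots> = prod_arr C f g \<cdot> I\<^sub>m Y \<cdot> (I\<^sub>e Y \<cdot> e)"
    using hom Cmp_Cmp[of e "I\<^sub>e Y" "I\<^sub>m Y"] Cmp_Cmp[of "I\<^sub>e Y \<cdot> e" "I\<^sub>m Y" "prod_arr C f g"]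
    by (simp add: Cmp_Arr Cod_Cmp)
  finally have sq: "I\<^sub>m Z \<cdot> (I\<^sub>e Z \<cdot> (f \<cdot> e)) = prod_arr C f g \<cdot> I\<^sub>m Y \<cdot> (I\<^sub>e Y \<cdot> e)" .
  have "I\<^sub>e Y \<cdot> e \<in> E"
    using E_Cmp[OF e rel_id(1)[OF Y]] hom by simp
  then have orth: "orthogonal C (I\<^sub>e Y \<cdot> e) (I\<^sub>m Z)"
    using E_M_orthogonal rel_id(2)[OF Z] by blast
  obtain d where d: "in_hom C d (Cod C (I\<^sub>e Y \<cdot> e)) (Dom C (I\<^sub>m Z))" "I\<^sub>m Z \<cdot> d = prod_arr C f g \<cdot> I\<^sub>m Y"
    by (rule orthogonal_lift[OF orth _ _ sq])
      (use hom in \<open>simp_all add: in_hom_def Cmp_Arr Dom_Cmp Cod_Cmp\<close>)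
  have "in_hom (rel_hcat C M) \<lparr>cell_dom = rel_id C E M Y, cell_cod = rel_id C E M Z,
      cell_left = f, cell_right = g, cell_arr = d\<rparr> (rel_id C E M Y) (rel_id C E M Z)"
    using d hom by (intro rel_cell_hom is_rel_rel_id)
      (simp_all add: in_hom_def apex_def rel_id(9,10) Cod_Cmp)
  then show thesis
    unfolding Y_def by (rule that) simp_all
qed

text \<open>The two identity relations are treated differently. On \<open>B\<close> the cover is
  epi, so the two legs coincide and the cell equates \<open>f\<close> after the left leg of
  \<open>A\<close> with \<open>g\<close> after the right leg. On \<open>A\<close> the cover serves
  as a common section of the legs. A single cell suffices, so the hom-categories are even discrete
  up to parallel cells.\<close>

lemma unit_cell_sides_eq:
  assumes epi: "\<forall>e\<in>E. is_epi C e" and A: "A \<in> Obj C" and B: "B \<in> Obj C"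
    and \<alpha>: "in_hom (rel_hcat C M) \<alpha> (rel_id C E M A) (rel_id C E M B)"
  shows "cell_left \<alpha> = cell_right \<alpha>"
proof -
  note \<alpha>D = rel_hcat_homD[OF \<alpha>]
  let ?f = "cell_left \<alpha>" and ?g = "cell_right \<alpha>" and ?d = "cell_arr \<alpha>"
  have fgd: "?f \<in> Arr C" "Dom C ?f = A" "Cod C ?f = B" "?g \<in> Arr C" "Dom C ?g = A" "Cod C ?g = B"
    "?d \<in> Arr C" "Dom C ?d = Dom C (I\<^sub>m A)" "Cod C ?d = Dom C (I\<^sub>m B)"
    using \<alpha>D(3-5) rel_id(9,10) A B by (auto simp: in_hom_def apex_def)
  note hom = fgd rel_id(3-7)[OF A] rel_id(3-7)[OF B] proj_hom[OF A A] proj_hom[OF B B] prod_arr_Arr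
  have legs: "\<pi>\<^sub>1 B B \<cdot> I\<^sub>m B = \<pi>\<^sub>2 B B \<cdot> I\<^sub>m B"
  proof -
    have "in_hom C (\<pi>\<^sub>1 B B \<cdot> I\<^sub>m B) (Cod C (I\<^sub>e B)) B" "in_hom C (\<pi>\<^sub>2 B B \<cdot> I\<^sub>m B) (Cod C (I\<^sub>e B)) B"
      using hom by (simp_all add: in_hom_def Cmp_Arr Dom_Cmp Cod_Cmp)
    moreover have "is_epi C (I\<^sub>e B)"
      using epi rel_id(1)[OF B] by blast
    ultimately show ?thesis
      using proj_rel_id_cover[OF B] unfolding is_epi_def by metis
  qed
  have "?f \<cdot> (\<pi>\<^sub>1 A A \<cdot> I\<^sub>m A) = \<pi>\<^sub>1 B B \<cdot> (I\<^sub>m B \<cdot> ?d)"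
    unfolding \<alpha>D(6) using hom by (simp add: proj_prod_arr_Cmp)
  also have "\<dots> = \<pi>\<^sub>1 B B \<cdot> I\<^sub>m B \<cdot> ?d"
    using hom by (simp add: Cmp_Cmp)
  also have "\<dots> = \<pi>\<^sub>2 B B \<cdot> (I\<^sub>m B \<cdot> ?d)"
    unfolding legs using hom by (simp add: Cmp_Cmp)
  also have "\<dots> = ?g \<cdot> (\<pi>\<^sub>2 A A \<cdot> I\<^sub>m A)"
    unfolding \<alpha>D(6) using hom by (simp add: proj_prod_arr_Cmp)
  finally have eq: "?f \<cdot> (\<pi>\<^sub>1 A A \<cdot> I\<^sub>m A) = ?g \<cdot> (\<pi>\<^sub>2 A A \<cdot> I\<^sub>m A)" .
  \<comment> \<open>Precomposition with the cover of \<open>A\<close> turns both legs into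
    identities and leaves the bare sides.\<close>
  have "?f = ?f \<cdot> (\<pi>\<^sub>1 A A \<cdot> I\<^sub>m A \<cdot> I\<^sub>e A)"
    unfolding proj_rel_id_cover[OF A] using hom by (simp add: Cmp_Idn_Dom)
  also have "\<dots> = ?f \<cdot> (\<pi>\<^sub>1 A A \<cdot> I\<^sub>m A) \<cdot> I\<^sub>e A"
    using hom by (simp add: Cmp_Cmp Cmp_Arr Dom_Cmp Cod_Cmp)
  also have "\<dots> = ?g \<cdot> (\<pi>\<^sub>2 A A \<cdot> I\<^sub>m A \<cdot> I\<^sub>e A)"
    unfolding eq using hom by (simp add: Cmp_Cmp Cmp_Arr Dom_Cmp Cod_Cmp)
  also have "\<dots> = ?g"
    unfolding proj_rel_id_cover[OF A] using hom by (simp add: Cmp_Idn_Dom)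
  finally show ?thesis .
qed

text \<open>The condition \<open>f \<cdot> e = g \<cdot> e\<close> is symmetric in \<open>f\<close>
  and \<open>g\<close>, so the construction of unit cells applies in both directions and
  antisymmetry yields \<open>f = g\<close>.\<close>

lemma locally_posetal_Rel_iff: "locally_posetal (Rel C E M) \<longleftrightarrow> proper_factorisation_system C E M"
proof
  interpret Rel: unital_double_graph "Rel C E M"
    by (rule unital_double_graph_Rel)
  assume posetal: "locally_posetal (Rel C E M)"
  have "is_epi C e" if e: "e \<in> E" for e
    unfolding is_epi_def
  proof (intro conjI allI impI; (elim conjE)?)
    fix Z f g
    assume fg: "in_hom C f (Cod C e) Z" "in_hom C g (Cod C e) Z" "f \<cdot> e = g \<cdot> e"
    then have obj: "Cod C e \<in> Obj C" "Z \<in> Obj C"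
      using e E_Arr Cod_Obj by (auto simp: in_hom_def)
    obtain \<alpha> where "in_hom (rel_hcat C M) \<alpha> (rel_id C E M (Cod C e)) (rel_id C E M Z)"
      "cell_left \<alpha> = f" "cell_right \<alpha> = g"
      using unit_cell_from_coequalising[OF e fg] by blast
    moreover obtain \<beta> where "in_hom (rel_hcat C M) \<beta> (rel_id C E M (Cod C e)) (rel_id C E M Z)"
      "cell_left \<beta> = g" "cell_right \<beta> = f"
      using unit_cell_from_coequalising[OF e fg(2,1) fg(3)[symmetric]] by blast
    ultimately show "f = g"
      using posetal obj unfolding Rel.locally_posetal_iff Rel_simps by metis
  qed (use e E_Arr in blast)
  moreover have "locally_preordered (Rel C E M)"
    using posetal by (simp add: locally_posetal_def)
  ultimately show "proper_factorisation_system C E M"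
    using ofs locally_preordered_Rel_iff by (simp add: proper_factorisation_system_def)
next
  interpret Rel: unital_double_graph "Rel C E M"
    by (rule unital_double_graph_Rel)
  assume proper: "proper_factorisation_system C E M"
  then show "locally_posetal (Rel C E M)"
    using unit_cell_sides_eq locally_preordered_Rel_iff
    unfolding Rel.locally_posetal_iff Rel_simps proper_factorisation_system_def by blast
qed

end

theorem mainTheorem5:
  fixes D :: "('o, 'v, 'h, 'c) dblcat"
    and C :: "('p, 'a) cat" and E M :: "'a set"
    and F :: "('o, 'v, 'h, 'c, 'p, 'a, ('p, 'a) hrel, ('p, 'a) rel_cell) dftor"
  assumes "relations_presentation D C E M F"
  shows "locally_posetal D \<longleftrightarrow>
    proper_factorisation_system (VCat D) (accompanying_class D F E) (accompanying_class D F M)"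
proof -
  have D: "unital_double_graph D" and eqv: "double_equivalence D (Rel C E M) F"
    and C: "category C" "has_finite_limits C" "orthogonal_factorisation_system C E M"
    using assms double_category.unital_double_graph
    by (auto simp: relations_presentation_def stable_factorisation_system_def)
  interpret relations C E M
    using C by (simp add: relations_def factorisation_system_def factorisation_system_axioms_def
        relations_axioms_def)
  note transfer = double_equivalence_locally_posetal_iff[OF eqv D unital_double_graph_Rel]
  obtain G \<eta> \<eta>' \<epsilon> \<epsilon>' where "equivalent_categories (VCat D) C (DF0 F) G \<eta> \<eta>' \<epsilon> \<epsilon>'"
    using transfer(2) by auto
  then interpret vertical: equivalent_categories "VCat D" C "DF0 F" G \<eta> \<eta>' \<epsilon> \<epsilon>' .
  \<comment> \<open>The accompanying classes are the inverse images along the vertical equivalence,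
    so the transport of properness applies to them.\<close>
  have "accompanying_class D F S = vertical.preimage S" for S
    by (simp add: accompanying_class_def vertical.preimage_def)
  then show ?thesis
    using transfer(1) locally_posetal_Rel_iff vertical.proper_preimage_iff[OF ofs] by simp
qed

end
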